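(* (Compositionality of DDS.) Let $F=F_1\wedge\dots\wedge F_k$ be a CNF formula with $\mathrm{Vars}(F_i)\cap\mathrm{Vars}(F_j)=\emptyset$ for $i\neq j$, and let $\exists X[F]$ be an $\exists$CNF formula. Let $T$ be the search tree built by the (modified) algorithm DDS described in the context when solving the quantifier elimination problem for $\exists X[F]$, i.e. when called on $\exists X[F]$ with $q=\emptyset$, $\Omega=\emptyset$. Let $X_i=X\cap\mathrm{Vars}(F_i)$ and $Y_i=\mathrm{Vars}(F_i)\setminus X$. Then, no matter how decision branching variables are chosen, the size of $T$ in the number of nodes is bounded by $$|\mathrm{Vars}(F)|\cdot\bigl(\eta(X_1\cup Y_1)+\dots+\eta(X_k\cup Y_k)\bigr),\qquad \eta(X_i\cup Y_i)=2\cdot 3^{|X_i\cup Y_i|}\cdot(|X_i|+1),\ i=1,\dots,k.$$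
   Context: Basics. A CNF formula is a finite set (conjunction) of clauses. $\mathrm{Vars}(\cdot)$ denotes the variables of a clause, formula or assignment. Assignments may be partial and are treated as sets of single-variable assignments. An $\exists$CNF formula is $\exists X[F]$ with $X\subseteq\mathrm{Vars}(F)$; put $Y=\mathrm{Vars}(F)\setminus X$. The quantifier elimination problem is to find a CNF formula $G$ with $G\equiv\exists X[F]$. $F_q$ is obtained from $F$ by removing the clauses satisfied by $q$ and deleting from the others the literals falsified by $q$. Two clauses are resolvable on $v$ if $v$ is the only variable of which they have opposite literals; their resolvent consists of all their literals except those of $v$. Two assignments are resolvable on $v$ if $v$ is the only variable they assign differently; their resolvent is the union of the two assignments minus those to $v$. D-sequents. DDS manipulates expressions $s\rightarrow\{x\}$ ("D-sequents") with $s$ an assignment to $\mathrm{Vars}(F)$ and $x\in X$ (recording that $x$ is redundant in subspace $s$). It is active in $q$ if $s\subseteq q$. It is symmetric in $v$ if $s$ contains no assignment to $v$, and asymmetric in $v$ otherwise. Joining $s'\rightarrow\{x\}$ and $s''\rightarrow\{x\}$ at $v$, where $s',s''$ are resolvable on $v$, yields $s\rightarrow\{x\}$ with $s$ the resolvent of $s',s''$ on $v$. A variable of $X$ is currently redundant if $\Omega$ contains a D-sequent for it; a clause is redundant if it contains a currently redundant variable. Input of DDS: a formula $\exists X[F]$, an assignment $q$ to $\mathrm{Vars}(F)$, and a set $\Omega$ of active D-sequents stating redundancy of some variables of $X\setminus\mathrm{Vars}(q)$. Output: the formula $\exists X[F]$ (with resolvent clauses possibly added to $F$), a set $\Omega$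 of active D-sequents stating redundancy of every variable of $X\setminus\mathrm{Vars}(q)$, an answer sat or unsat (according to whether $F_q$ is satisfiable), and in case unsat a clause of $F$ falsified by $q$. Throughout, $\Omega$ denotes a set of active D-sequents. Procedure UnsatClause($C$), where $C\in F$ is falsified by $q$: for each $x\in X\setminus\mathrm{Vars}(q)$ whose D-sequent is not in $\Omega$, add $s\rightarrow\{x\}$ to $\Omega$, where $s$ is the shortest assignment falsifying $C$. Blocked-variable D-sequent for an unassigned, not currently redundant $x\in X$: applicable if for every pair of clauses of $F$ resolvable on $x$ at least one of the two is satisfied by $q$ or redundant. For each such pair choose such a clause $C'$; $s\subseteq q$ is the union over pairs of: one single-variable assignment of $q$ satisfying $C'$, if $q$ satisfies $C'$; otherwise the assignment $s^*$ of a D-sequent $s^*\rightarrow\{x^*\}$ in $\Omega$ with $x^*\in\mathrm{Vars}(C')$. The D-sequent is $s\rightarrow\{x\}$. $\mathrm{DDS}(\exists X[F],q,\Omega)$: 1. If some $C\in F$ is falsified by $q$: apply UnsatClause($C$); return (unsat, $C$). 2. Otherwise add to $\Omega$ blocked-variable D-sequents for the variables of $X\setminus\mathrm{Vars}(q)$ that have no D-sequent in $\Omega$ and to which this is applicable. If every variable of $X\setminus\mathrm{Vars}(q)$ has a D-sequent in $\Omega$, return sat. 3. Pick a branching variable $v$: an unassigned $y\in Y$ that is not detached, if there is one; otherwise an unassigned $x\in X$ that is not currently redundant. ($y$ is detached if every clause of $F_q$ containing $y$ and at least one variable of $X$ is redundant.) Among the allowed variables, preference is given to variables of unit clauses of $F_q$;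 for such a variable the value falsifying the unit clause is explored first. Below, $v=0$ is the first value explored (the roles of 0 and 1 may be swapped). 4. Left branch: call DDS with $q\cup\{v=0\}$ and $\Omega$, updating $F$ and $\Omega$; let $ans_0$ (and $C_0$ if unsat) be its answer. Let $\Omega^{asym}$ be the set of D-sequents of $\Omega$ asymmetric in $v$. 5. If $\Omega^{asym}=\emptyset$: return the result of the left branch (the current formula, $\Omega$, $ans_0$, $C_0$). 6. Right branch: replace $\Omega$ by $\Omega\setminus\Omega^{asym}$ and call DDS with $q\cup\{v=1\}$ and $\Omega$, updating $F$ and $\Omega$; let $ans_1$ (and $C_1$ if unsat) be its answer. 7. If both answers are unsat: let $C$ be the resolvent of $C_0,C_1$ on $v$ (if one of $C_0,C_1$ does not contain $v$, then $C$ is that clause itself and no new clause arises); put $F:=F\wedge C$; apply UnsatClause($C$) for $q$; return (unsat, $C$). 8. Otherwise, for each $x$ having a D-sequent $S_0\in\Omega^{asym}$, let $S_1$ be its D-sequent from the right branch. If $S_1$ is asymmetric in $v$, replace $S_1$ in $\Omega$ by the join of $S_0,S_1$ at $v$. If $S_1$ is symmetric in $v$: keep it if $ans_0=$ unsat; otherwise add $(v=1)$ to its assignment and replace it by the join of the result with $S_0$ at $v$. Then, if $v\in X$, add to $\Omega$ the blocked-variable D-sequent for $v$ (with respect to $q$ and the current $\Omega$). Return sat. Modification used here: all D-sequents ever derived are kept in a set $\Pi$, and the same D-sequent is never derived twice: if $\Pi$ contains a D-sequent $s\rightarrow\{x\}$, then $x$ is declared redundant as soon as this D-sequent becomes active (i.e.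 $s\subseteq q$ for the current $q$) instead of the D-sequent being derived again. The search tree $T$ is the binary tree of recursive calls of DDS. A decision branching variable is a branching variable that was not present in a unit clause of the current formula ($F_q$) when it was selected for branching.
   Formalization: Vars(F) is assumed nonempty. Where DDS's steps contradict its Output, the Output wins: step 5 skips the right branch only if an unsat answer's clause is falsified by q; in step 8, if F now contains a clause falsified by q, UnsatClause is applied and unsat returned. *)

theory Defs
  imports Main
begin

section \<open>CNF formulas and partial assignments\<close>

text \<open>The pair \<open>(v, b)\<close> serves both as the literal of \<open>v\<close> that is true under \<open>v = b\<close> and as the
  single-variable assignment \<open>v = b\<close>.  A clause is thus the disjunction, and a partial
  assignment the conjunction, of the pairs it contains.\<close>

type_synonym 'v lit = "'v \<times> bool"
type_synonym 'v clause = "'v lit set"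
type_synonym 'v cnf = "'v clause set"
type_synonym 'v assignment = "'v lit set"
type_synonym 'v dseq = "'v assignment \<times> 'v"

definition compl :: "'v lit \<Rightarrow> 'v lit" where
  "compl l = (fst l, \<not> snd l)"

definition vars :: "'v lit set \<Rightarrow> 'v set" where
  "vars A = fst ` A"

definition cnf_vars :: "'v cnf \<Rightarrow> 'v set" where
  "cnf_vars F = (\<Union>C\<in>F. vars C)"

text \<open>As usual, a clause does not contain a variable in both polarities.\<close>

definition is_clause :: "'v clause \<Rightarrow> bool" where
  "is_clause C \<longleftrightarrow> finite C \<and> (\<forall>l\<in>C. compl l \<notin> C)"

definition is_cnf :: "'v cnf \<Rightarrow> bool" where
  "is_cnf F \<longleftrightarrow> finite F \<and> (\<forall>C\<in>F. is_clause C)"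

definition satisfies :: "'v assignment \<Rightarrow> 'v clause \<Rightarrow> bool" where
  "satisfies q C \<longleftrightarrow> q \<inter> C \<noteq> {}"

text \<open>The shortest assignment falsifying a clause.\<close>

definition falsifier :: "'v clause \<Rightarrow> 'v assignment" where
  "falsifier C = compl ` C"

definition falsifies :: "'v assignment \<Rightarrow> 'v clause \<Rightarrow> bool" where
  "falsifies q C \<longleftrightarrow> falsifier C \<subseteq> q"

text \<open>The formula \<open>F\<^sub>q\<close>.\<close>

definition restrict :: "'v cnf \<Rightarrow> 'v assignment \<Rightarrow> 'v cnf" where
  "restrict F q = {{l \<in> C. compl l \<notin> q} | C. C \<in> F \<and> \<not> satisfies q C}"

text \<open>Both notions below apply to clauses (opposite literals) and to assignments (variables
  assigned differently).\<close>

definition resolvable :: "'v \<Rightarrow> 'v lit set \<Rightarrow> 'v lit set \<Rightarrow> bool" where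
  "resolvable v A B \<longleftrightarrow> {w. \<exists>b. (w, b) \<in> A \<and> (w, \<not> b) \<in> B} = {v}"

definition resolvent :: "'v \<Rightarrow> 'v lit set \<Rightarrow> 'v lit set \<Rightarrow> 'v lit set" where
  "resolvent v A B = {l \<in> A \<union> B. fst l \<noteq> v}"


section \<open>D-sequents\<close>

definition active :: "'v assignment \<Rightarrow> 'v dseq set \<Rightarrow> 'v dseq set" where
  "active q \<Omega> = {(s, x) \<in> \<Omega>. s \<subseteq> q}"

definition asymmetric :: "'v \<Rightarrow> 'v dseq set \<Rightarrow> 'v dseq set" where
  "asymmetric v \<Omega> = {(s, x) \<in> \<Omega>. v \<in> vars s}"

text \<open>The currently redundant variables.\<close>

definition red_vars :: "'v dseq set \<Rightarrow> 'v set" where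
  "red_vars \<Omega> = snd ` \<Omega>"

definition red_clause :: "'v dseq set \<Rightarrow> 'v clause \<Rightarrow> bool" where
  "red_clause \<Omega> C \<longleftrightarrow> vars C \<inter> red_vars \<Omega> \<noteq> {}"

text \<open>Reuse of the stored D-sequents \<open>\<Pi>\<close>: every variable without a D-sequent in \<open>\<Omega>\<close> for which
  \<open>\<Pi>\<close> has an active D-sequent receives one such D-sequent.\<close>

definition reuse :: "'v set \<Rightarrow> 'v dseq set \<Rightarrow> 'v assignment \<Rightarrow> 'v dseq set \<Rightarrow> 'v dseq set \<Rightarrow> bool" where
  "reuse X \<Pi> q \<Omega> \<Omega>' \<longleftrightarrow>
     (\<exists>f. (let R = {x \<in> X - vars q - red_vars \<Omega>. \<exists>s. (s, x) \<in> active q \<Pi>} in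
        (\<forall>x\<in>R. (f x, x) \<in> active q \<Pi>) \<and> \<Omega>' = \<Omega> \<union> (\<lambda>x. (f x, x)) ` R))"

definition unsat_clause ::
  "'v set \<Rightarrow> 'v assignment \<Rightarrow> 'v clause \<Rightarrow> 'v dseq set \<Rightarrow> 'v dseq set" where
  "unsat_clause X q C \<Omega> = \<Omega> \<union> {falsifier C} \<times> (X - vars q - red_vars \<Omega>)"

text \<open>A pair of clauses resolvable on \<open>x\<close> is listed once, with the positive literal of \<open>x\<close> in the
  first component.\<close>

definition res_pairs :: "'v cnf \<Rightarrow> 'v \<Rightarrow> ('v clause \<times> 'v clause) set" where
  "res_pairs F x = {(C, D). C \<in> F \<and> D \<in> F \<and> (x, True) \<in> C \<and> (x, False) \<in> D \<and> resolvable x C D}"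

text \<open>\<open>reason q \<Omega> C s\<close>: \<open>s\<close> is a possible contribution to the assignment of a blocked-variable
  D-sequent when \<open>C\<close> is the clause chosen from a pair; it exists iff \<open>C\<close> is satisfied by \<open>q\<close> or
  redundant.\<close>

definition reason :: "'v assignment \<Rightarrow> 'v dseq set \<Rightarrow> 'v clause \<Rightarrow> 'v assignment \<Rightarrow> bool" where
  "reason q \<Omega> C s \<longleftrightarrow>
     (if satisfies q C then \<exists>l \<in> q \<inter> C. s = {l} else \<exists>x \<in> vars C. (s, x) \<in> \<Omega>)"

definition blocked_dseq ::
  "'v cnf \<Rightarrow> 'v assignment \<Rightarrow> 'v dseq set \<Rightarrow> 'v \<Rightarrow> 'v dseq \<Rightarrow> bool" where
  "blocked_dseq F q \<Omega> x S \<longleftrightarrow>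
     (\<exists>r. (\<forall>(C, D)\<in>res_pairs F x. reason q \<Omega> C (r (C, D)) \<or> reason q \<Omega> D (r (C, D)))
        \<and> S = (\<Union> (r ` res_pairs F x), x))"

inductive blocked_step ::
  "'v set \<Rightarrow> 'v cnf \<Rightarrow> 'v assignment \<Rightarrow> 'v dseq set \<Rightarrow> 'v dseq set \<Rightarrow> bool" for X F q where
  "x \<in> X - vars q \<Longrightarrow> x \<notin> red_vars \<Omega> \<Longrightarrow> blocked_dseq F q \<Omega> x S
     \<Longrightarrow> blocked_step X F q \<Omega> (insert S \<Omega>)"

text \<open>A new D-sequent may make the rule applicable to further variables; it is applied until it is
  applicable to none.\<close>

definition add_blocked ::
  "'v set \<Rightarrow> 'v cnf \<Rightarrow> 'v assignment \<Rightarrow> 'v dseq set \<Rightarrow> 'v dseq set \<Rightarrow> bool" where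
  "add_blocked X F q \<Omega> \<Omega>' \<longleftrightarrow> (blocked_step X F q)\<^sup>*\<^sup>* \<Omega> \<Omega>' \<and> (\<nexists>\<Omega>''. blocked_step X F q \<Omega>' \<Omega>'')"


section \<open>Branching\<close>

definition detached :: "'v set \<Rightarrow> 'v cnf \<Rightarrow> 'v assignment \<Rightarrow> 'v dseq set \<Rightarrow> 'v \<Rightarrow> bool" where
  "detached X F q \<Omega> y \<longleftrightarrow>
     (\<forall>C \<in> restrict F q. y \<in> vars C \<longrightarrow> vars C \<inter> X \<noteq> {} \<longrightarrow> red_clause \<Omega> C)"

definition branch_vars :: "'v set \<Rightarrow> 'v cnf \<Rightarrow> 'v assignment \<Rightarrow> 'v dseq set \<Rightarrow> 'v set" where
  "branch_vars X F q \<Omega> =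
     (let U = {y \<in> cnf_vars F - X - vars q. \<not> detached X F q \<Omega> y}
      in if U \<noteq> {} then U else X - vars q - red_vars \<Omega>)"

text \<open>\<open>v\<close> may be selected, with \<open>v = b\<close> explored first.  When some allowed variable is in a unit
  clause of \<open>F\<^sub>q\<close>, such a variable is selected and \<open>v = b\<close> falsifies its unit clause; otherwise \<open>v\<close>
  is a decision variable and \<open>v\<close> and \<open>b\<close> are unconstrained.\<close>

definition pick_branch ::
  "'v set \<Rightarrow> 'v cnf \<Rightarrow> 'v assignment \<Rightarrow> 'v dseq set \<Rightarrow> 'v \<Rightarrow> bool \<Rightarrow> bool" where
  "pick_branch X F q \<Omega> v b \<longleftrightarrow>
     v \<in> branch_vars X F q \<Omega> \<and>
     ((\<exists>w \<in> branch_vars X F q \<Omega>. \<exists>c. {(w, c)} \<in> restrict F q) \<longrightarrow> {(v, \<not> b)} \<in> restrict F q)"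

text \<open>The case in which a call at \<open>q\<close> proceeds to branching.\<close>

definition branches ::
  "'v set \<Rightarrow> 'v cnf \<Rightarrow> 'v dseq set \<Rightarrow> 'v assignment \<Rightarrow> 'v dseq set \<Rightarrow> 'v dseq set \<Rightarrow>
   'v \<Rightarrow> bool \<Rightarrow> bool" where
  "branches X F \<Pi> q \<Omega> \<Omega>' v b \<longleftrightarrow>
     (\<exists>\<Omega>\<^sub>r. reuse X \<Pi> q \<Omega> \<Omega>\<^sub>r \<and> (\<nexists>C. C \<in> F \<and> falsifies q C) \<and> add_blocked X F q \<Omega>\<^sub>r \<Omega>') \<and>
     \<not> X - vars q \<subseteq> red_vars \<Omega>' \<and> pick_branch X F q \<Omega>' v b"


section \<open>Combining the two branches\<close>

datatype 'v answer = Sat | Unsat "'v clause"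

definition combine_clauses :: "'v \<Rightarrow> 'v clause \<Rightarrow> 'v clause \<Rightarrow> 'v clause \<Rightarrow> bool" where
  "combine_clauses v C\<^sub>0 C\<^sub>1 C \<longleftrightarrow>
     (if v \<in> vars C\<^sub>0 \<and> v \<in> vars C\<^sub>1 then C = resolvent v C\<^sub>0 C\<^sub>1
      else C \<in> {C\<^sub>0, C\<^sub>1} \<and> v \<notin> vars C)"

text \<open>The assignment of the D-sequent that replaces \<open>s\<^sub>1 \<rightarrow> {x}\<close> (second branch, \<open>v = b\<close>), given
  \<open>s\<^sub>0 \<rightarrow> {x}\<close> from the first branch, which is asymmetric in \<open>v\<close> and had the answer \<open>ans\<^sub>0\<close>.\<close>

definition merge_dseq ::
  "'v \<Rightarrow> bool \<Rightarrow> 'v answer \<Rightarrow> 'v assignment \<Rightarrow> 'v assignment \<Rightarrow> 'v assignment" where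
  "merge_dseq v b ans\<^sub>0 s\<^sub>0 s\<^sub>1 =
     (if v \<in> vars s\<^sub>1 then resolvent v s\<^sub>0 s\<^sub>1
      else if ans\<^sub>0 \<noteq> Sat then s\<^sub>1
      else resolvent v s\<^sub>0 (insert (v, b) s\<^sub>1))"

text \<open>A variable of \<open>A\<close> may lack a D-sequent from the second branch: when the second of two branches
  is skipped at some \<open>v \<in> X\<close>, no D-sequent for \<open>v\<close> is derived there.  It then has none at \<open>q\<close>.\<close>

definition merge ::
  "'v assignment \<Rightarrow> 'v \<Rightarrow> bool \<Rightarrow> 'v answer \<Rightarrow> 'v dseq set \<Rightarrow> 'v dseq set \<Rightarrow> 'v dseq set" where
  "merge q v b ans\<^sub>0 A \<Omega>\<^sub>1 =
     {(s, x) \<in> active q \<Omega>\<^sub>1. x \<notin> red_vars A} \<union>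
     {(merge_dseq v b ans\<^sub>0 s\<^sub>0 s\<^sub>1, x) | s\<^sub>0 s\<^sub>1 x. (s\<^sub>0, x) \<in> A \<and> (s\<^sub>1, x) \<in> \<Omega>\<^sub>1}"

definition add_branch_var ::
  "'v set \<Rightarrow> 'v cnf \<Rightarrow> 'v assignment \<Rightarrow> 'v \<Rightarrow> 'v dseq set \<Rightarrow> 'v dseq set \<Rightarrow> bool" where
  "add_branch_var X F q v \<Omega> \<Omega>' \<longleftrightarrow>
     (if v \<in> X \<and> (\<exists>S. blocked_dseq F q \<Omega> v S)
      then \<exists>S. blocked_dseq F q \<Omega> v S \<and> \<Omega>' = insert S \<Omega> else \<Omega>' = \<Omega>)"

text \<open>\<open>conclude X q v b A ans\<^sub>0 F \<Omega>\<^sub>1 ans\<^sub>1 F' \<Omega>' ans\<close>: the processing after both branches, where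
  \<open>v = b\<close> is the value explored second, \<open>A\<close> the set of D-sequents of the first branch asymmetric in
  \<open>v\<close>, and \<open>F\<close> and \<open>\<Omega>\<^sub>1\<close> come from the second branch.

  As \<open>\<Omega>\<close> holds active D-sequents only, those containing an assignment to \<open>v\<close> are dropped on return
  to \<open>q\<close> unless they are merged.

  An answer \<open>unsat\<close> has to be given when \<open>F\<^sub>q\<close> is unsatisfiable.  The rule \<open>contradicted\<close> observes
  this in the case that a branch answered \<open>sat\<close> but \<open>F\<close> meanwhile contains a clause falsified by
  \<open>q\<close>.  This happens when a contradiction among clauses without quantified variables is hidden
  from one branch because their variables are detached there, and found in the other branch.\<close>

inductive conclude ::
  "'v set \<Rightarrow> 'v assignment \<Rightarrow> 'v \<Rightarrow> bool \<Rightarrow> 'v dseq set \<Rightarrow> 'v answer \<Rightarrow>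
   'v cnf \<Rightarrow> 'v dseq set \<Rightarrow> 'v answer \<Rightarrow> 'v cnf \<Rightarrow> 'v dseq set \<Rightarrow> 'v answer \<Rightarrow> bool"
  for X q v b A where
  both_unsat:
    "combine_clauses v C\<^sub>0 C\<^sub>1 C \<Longrightarrow>
     conclude X q v b A (Unsat C\<^sub>0) F \<Omega>\<^sub>1 (Unsat C\<^sub>1)
       (insert C F) (unsat_clause X q C (active q \<Omega>\<^sub>1)) (Unsat C)"
| contradicted:
    "ans\<^sub>0 = Sat \<or> ans\<^sub>1 = Sat \<Longrightarrow> C \<in> F \<Longrightarrow> falsifies q C \<Longrightarrow>
     conclude X q v b A ans\<^sub>0 F \<Omega>\<^sub>1 ans\<^sub>1
       F (unsat_clause X q C (active q \<Omega>\<^sub>1)) (Unsat C)"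
| some_sat:
    "ans\<^sub>0 = Sat \<or> ans\<^sub>1 = Sat \<Longrightarrow> \<nexists>C. C \<in> F \<and> falsifies q C \<Longrightarrow>
     add_branch_var X F q v (merge q v b ans\<^sub>0 A \<Omega>\<^sub>1) \<Omega>' \<Longrightarrow>
     conclude X q v b A ans\<^sub>0 F \<Omega>\<^sub>1 ans\<^sub>1 F \<Omega>' Sat"


section \<open>The procedure DDS and its search tree\<close>

datatype 'v search_tree =
    Leaf
  | Left_Only 'v "'v search_tree"
  | Both 'v "'v search_tree" "'v search_tree"

primrec nodes :: "'v search_tree \<Rightarrow> nat" where
  "nodes Leaf = 1"
| "nodes (Left_Only v T) = 1 + nodes T"
| "nodes (Both v T\<^sub>0 T\<^sub>1) = 1 + nodes T\<^sub>0 + nodes T\<^sub>1"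

text \<open>The answer of the first branch is a correct answer for \<open>q\<close> as well: a clause returned with
  \<open>unsat\<close> is falsified by \<open>q\<close>.\<close>

fun transferable :: "'v assignment \<Rightarrow> 'v answer \<Rightarrow> bool" where
  "transferable q Sat \<longleftrightarrow> True"
| "transferable q (Unsat C) \<longleftrightarrow> falsifies q C"

text \<open>\<open>dds X F \<Pi> q \<Omega> T F' \<Pi>' \<Omega>' ans\<close>: the call of DDS on \<open>\<exists>X[F]\<close>, \<open>q\<close>, \<open>\<Omega>\<close>, with the stored
  D-sequents \<open>\<Pi>\<close>, can build the search tree \<open>T\<close> and return the formula \<open>\<exists>X[F']\<close>, the D-sequents
  \<open>\<Omega>'\<close> and the answer \<open>ans\<close>, where \<open>\<Pi>'\<close> are the D-sequents stored on return.  All choices of the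
  procedure are left open.

  The second branch is skipped if no D-sequent of the first branch is asymmetric in \<open>v\<close> and the
  result of the first branch can be returned for \<open>q\<close>.  Without the latter condition a call could
  return a clause not falsified by \<open>q\<close>: for \<open>F = (x) \<and> (\<not>x)\<close>, \<open>X = {x}\<close>, the branch \<open>x = 0\<close> returns
  the clause \<open>(x)\<close> and no D-sequents.\<close>

inductive dds ::
  "'v set \<Rightarrow> 'v cnf \<Rightarrow> 'v dseq set \<Rightarrow> 'v assignment \<Rightarrow> 'v dseq set \<Rightarrow> 'v search_tree \<Rightarrow>
   'v cnf \<Rightarrow> 'v dseq set \<Rightarrow> 'v dseq set \<Rightarrow> 'v answer \<Rightarrow> bool"
  for X where
  unsat_leaf:
    "reuse X \<Pi> q \<Omega> \<Omega>\<^sub>r \<Longrightarrow> C \<in> F \<Longrightarrow> falsifies q C \<Longrightarrow> \<Omega>' = unsat_clause X q C \<Omega>\<^sub>r \<Longrightarrow>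
     dds X F \<Pi> q \<Omega> Leaf F (\<Pi> \<union> \<Omega>') \<Omega>' (Unsat C)"
| sat_leaf:
    "reuse X \<Pi> q \<Omega> \<Omega>\<^sub>r \<Longrightarrow> \<nexists>C. C \<in> F \<and> falsifies q C \<Longrightarrow> add_blocked X F q \<Omega>\<^sub>r \<Omega>' \<Longrightarrow>
     X - vars q \<subseteq> red_vars \<Omega>' \<Longrightarrow>
     dds X F \<Pi> q \<Omega> Leaf F (\<Pi> \<union> \<Omega>') \<Omega>' Sat"
| left_only:
    "branches X F \<Pi> q \<Omega> \<Omega>\<^sub>b v b \<Longrightarrow>
     dds X F (\<Pi> \<union> \<Omega>\<^sub>b) (insert (v, b) q) \<Omega>\<^sub>b T\<^sub>0 F\<^sub>0 \<Pi>\<^sub>0 \<Omega>\<^sub>0 ans\<^sub>0 \<Longrightarrow>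
     asymmetric v \<Omega>\<^sub>0 = {} \<Longrightarrow> transferable q ans\<^sub>0 \<Longrightarrow>
     dds X F \<Pi> q \<Omega> (Left_Only v T\<^sub>0) F\<^sub>0 \<Pi>\<^sub>0 \<Omega>\<^sub>0 ans\<^sub>0"
| both:
    "branches X F \<Pi> q \<Omega> \<Omega>\<^sub>b v b \<Longrightarrow>
     dds X F (\<Pi> \<union> \<Omega>\<^sub>b) (insert (v, b) q) \<Omega>\<^sub>b T\<^sub>0 F\<^sub>0 \<Pi>\<^sub>0 \<Omega>\<^sub>0 ans\<^sub>0 \<Longrightarrow>
     A = asymmetric v \<Omega>\<^sub>0 \<Longrightarrow> A \<noteq> {} \<or> \<not> transferable q ans\<^sub>0 \<Longrightarrow>
     dds X F\<^sub>0 \<Pi>\<^sub>0 (insert (v, \<not> b) q) (\<Omega>\<^sub>0 - A) T\<^sub>1 F\<^sub>1 \<Pi>\<^sub>1 \<Omega>\<^sub>1 ans\<^sub>1 \<Longrightarrow>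
     conclude X q v (\<not> b) A ans\<^sub>0 F\<^sub>1 \<Omega>\<^sub>1 ans\<^sub>1 F' \<Omega>' ans \<Longrightarrow>
     dds X F \<Pi> q \<Omega> (Both v T\<^sub>0 T\<^sub>1) F' (\<Pi>\<^sub>1 \<union> \<Omega>') \<Omega>' ans"

definition dds_search_tree :: "'v set \<Rightarrow> 'v cnf \<Rightarrow> 'v search_tree \<Rightarrow> bool" where
  "dds_search_tree X F T \<longleftrightarrow> (\<exists>F' \<Pi>' \<Omega>' ans. dds X F {} {} {} T F' \<Pi>' \<Omega>' ans)"

definition eta :: "'v set \<Rightarrow> 'v set \<Rightarrow> nat" where
  "eta X Y = 2 * 3 ^ card (X \<union> Y) * (card X + 1)"


section \<open>DDS has a run on every input\<close>

lemma reuse_total: "\<exists>\<Omega>'. reuse X \<Pi> q \<Omega> \<Omega>'"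
proof -
  let ?f = "\<lambda>x. SOME s. (s, x) \<in> active q \<Pi>"
  show ?thesis unfolding reuse_def Let_def
    by (intro exI[where x = ?f] exI conjI) (auto intro: someI)
qed

lemma add_blocked_total:
  assumes "finite X"
  shows "\<exists>\<Omega>'. add_blocked X F q \<Omega> \<Omega>'"
proof (induction "card (X - red_vars \<Omega>)" arbitrary: \<Omega> rule: less_induct)
  case less
  show ?case
  proof (cases "\<exists>\<Omega>''. blocked_step X F q \<Omega> \<Omega>''")
    case True
    then obtain \<Omega>'' where st: "blocked_step X F q \<Omega> \<Omega>''" by blast
    then have "X - red_vars \<Omega>'' \<subset> X - red_vars \<Omega>"
      by cases (auto simp: red_vars_def blocked_dseq_def)
    with assms have "card (X - red_vars \<Omega>'') < card (X - red_vars \<Omega>)"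
      by (intro psubset_card_mono) auto
    from less[OF this] st show ?thesis unfolding add_blocked_def
      by (meson converse_rtranclp_into_rtranclp)
  qed (auto simp: add_blocked_def)
qed

lemma add_branch_var_total: "\<exists>\<Omega>'. add_branch_var X F q v \<Omega> \<Omega>'"
proof (cases "v \<in> X \<and> (\<exists>S. blocked_dseq F q \<Omega> v S)")
  case True
  then obtain S where "v \<in> X" "blocked_dseq F q \<Omega> v S" by blast
  then have "add_branch_var X F q v \<Omega> (insert S \<Omega>)" unfolding add_branch_var_def by metis
  then show ?thesis ..
next
  case False
  then have "add_branch_var X F q v \<Omega> \<Omega>" unfolding add_branch_var_def by metis
  then show ?thesis ..
qed

lemma conclude_total:
  assumes "\<forall>C. ans\<^sub>0 = Unsat C \<longrightarrow> vars C \<subseteq> V" "\<forall>C. ans\<^sub>1 = Unsat C \<longrightarrow> vars C \<subseteq> V" "cnf_vars F \<subseteq> V"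
  shows "\<exists>F' \<Omega>' ans. conclude X q v b A ans\<^sub>0 F \<Omega>\<^sub>1 ans\<^sub>1 F' \<Omega>' ans \<and> F \<subseteq> F' \<and> cnf_vars F' \<subseteq> V \<and>
    (\<forall>C. ans = Unsat C \<longrightarrow> vars C \<subseteq> V)"
proof (cases "ans\<^sub>0 = Sat \<or> ans\<^sub>1 = Sat")
  case s: True
  show ?thesis
  proof (cases "\<exists>C. C \<in> F \<and> falsifies q C")
    case True
    with s assms show ?thesis by (fastforce intro: contradicted simp: cnf_vars_def)
  next
    case False
    have "\<exists>\<Omega>'. add_branch_var X F q v (merge q v b ans\<^sub>0 A \<Omega>\<^sub>1) \<Omega>'"
      by (rule add_branch_var_total)
    with s False assms show ?thesis by (blast intro: some_sat)
  qed
next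
  case False
  then obtain C\<^sub>0 C\<^sub>1 where u: "ans\<^sub>0 = Unsat C\<^sub>0" "ans\<^sub>1 = Unsat C\<^sub>1" by (metis answer.exhaust)
  have "\<exists>C. combine_clauses v C\<^sub>0 C\<^sub>1 C" by (auto simp: combine_clauses_def)
  then obtain C where C: "combine_clauses v C\<^sub>0 C\<^sub>1 C" by blast
  with assms u have "vars C \<subseteq> V"
    by (auto simp: combine_clauses_def resolvent_def vars_def split: if_splits)
  with assms have "cnf_vars (insert C F) \<subseteq> V" by (simp add: cnf_vars_def)
  with \<open>vars C \<subseteq> V\<close> show ?thesis
    unfolding u using both_unsat[OF C] by (metis answer.inject subset_insertI)
qed

lemma pick_total:
  assumes "\<not> X - vars q \<subseteq> red_vars \<Omega>"
  shows "\<exists>v b. pick_branch X F q \<Omega> v b"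
proof -
  have "branch_vars X F q \<Omega> \<noteq> {}" using assms by (auto simp: branch_vars_def Let_def)
  then obtain u where u: "u \<in> branch_vars X F q \<Omega>" by blast
  show ?thesis
  proof (cases "\<exists>w \<in> branch_vars X F q \<Omega>. \<exists>c. {(w, c)} \<in> restrict F q")
    case True
    then obtain w c where "w \<in> branch_vars X F q \<Omega>" "{(w, c)} \<in> restrict F q" by blast
    then have "pick_branch X F q \<Omega> w (\<not> c)" by (simp add: pick_branch_def)
    then show ?thesis by blast
  next
    case False
    with u show ?thesis by (auto simp: pick_branch_def)
  qed
qed

lemma dds_total:
  assumes "finite V" "X \<subseteq> cnf_vars F" "cnf_vars F \<subseteq> V"
  shows "\<exists>T F' \<Pi>' \<Omega>' ans. dds X F \<Pi> q \<Omega> T F' \<Pi>' \<Omega>' ans \<and> F \<subseteq> F' \<and> cnf_vars F' \<subseteq> V \<and>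
    (\<forall>C. ans = Unsat C \<longrightarrow> vars C \<subseteq> V)"
  using assms
proof (induction "card (V - vars q)" arbitrary: F \<Pi> q \<Omega> rule: less_induct)
  case less
  obtain \<Omega>r where r: "reuse X \<Pi> q \<Omega> \<Omega>r" using reuse_total by blast
  show ?case
  proof (cases "\<exists>C. C \<in> F \<and> falsifies q C")
    case True
    then obtain C where "C \<in> F" "falsifies q C" by blast
    with unsat_leaf[OF r this refl] less.prems show ?thesis by (fastforce simp: cnf_vars_def)
  next
    case nf: False
    have "finite X" using less.prems by (meson finite_subset)
    then obtain \<Omega>b where b: "add_blocked X F q \<Omega>r \<Omega>b" using add_blocked_total by blast
    show ?thesis
    proof (cases "X - vars q \<subseteq> red_vars \<Omega>b")
      case True
      with sat_leaf[OF r nf b True] less.prems show ?thesis by blast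
    next
      case False
      obtain v c where p: "pick_branch X F q \<Omega>b v c" using pick_total[OF False] by blast
      have br: "branches X F \<Pi> q \<Omega> \<Omega>b v c" using r nf b False p by (auto simp: branches_def)
      have v: "v \<in> V" "v \<notin> vars q" using p less.prems
        by (auto simp: pick_branch_def branch_vars_def Let_def split: if_splits)
      have lt: "card (V - vars (insert (v, d) q)) < card (V - vars q)" for d
        using v less.prems by (intro psubset_card_mono) (auto simp: vars_def)
      obtain T0 F0 \<Pi>0 \<Omega>0 a0 where d0: "dds X F (\<Pi> \<union> \<Omega>b) (insert (v, c) q) \<Omega>b T0 F0 \<Pi>0 \<Omega>0 a0"
        and i0: "F \<subseteq> F0" "cnf_vars F0 \<subseteq> V" "\<forall>C. a0 = Unsat C \<longrightarrow> vars C \<subseteq> V"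
        using less.hyps[OF lt less.prems] by blast
      show ?thesis
      proof (cases "asymmetric v \<Omega>0 = {} \<and> transferable q a0")
        case True
        with left_only[OF br d0] i0 show ?thesis by blast
      next
        case False
        have X: "X \<subseteq> cnf_vars F0" using i0(1) less.prems(2) by (force simp: cnf_vars_def)
        obtain T1 F1 \<Pi>1 \<Omega>1 a1 where
          d1: "dds X F0 \<Pi>0 (insert (v, \<not> c) q) (\<Omega>0 - asymmetric v \<Omega>0) T1 F1 \<Pi>1 \<Omega>1 a1"
          and i1: "F0 \<subseteq> F1" "cnf_vars F1 \<subseteq> V" "\<forall>C. a1 = Unsat C \<longrightarrow> vars C \<subseteq> V"
          using less.hyps[OF lt less.prems(1) X i0(2)] by blast
        obtain F' \<Omega>' a where "conclude X q v (\<not> c) (asymmetric v \<Omega>0) a0 F1 \<Omega>1 a1 F' \<Omega>' a" "F1 \<subseteq> F'"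
          "cnf_vars F' \<subseteq> V" "\<forall>C. a = Unsat C \<longrightarrow> vars C \<subseteq> V"
          using conclude_total[OF i0(3) i1(3) i1(2)] by blast
        with both[OF br d0 refl _ d1] False i0 i1 show ?thesis by blast
      qed
    qed
  qed
qed

lemma dds_search_tree_exists:
  "is_cnf F \<Longrightarrow> X \<subseteq> cnf_vars F \<Longrightarrow> \<exists>T. dds_search_tree X F T"
  using dds_total[of "cnf_vars F" X F "{}" "{}" "{}"]
  unfolding dds_search_tree_def is_cnf_def is_clause_def
  by (metis (no_types, lifting) cnf_vars_def finite_UN finite_imageI vars_def order_refl)

end

theory Submission
  imports Defs
begin

text \<open>Say that a D-sequent \<open>s \<rightarrow> {x}\<close> is local if \<open>s\<close> assigns only variables of the component of
  \<open>x\<close>.  Every derived D-sequent is local or has the falsifier of a clause as its assignment, and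
  every clause stays within one component.  Hence at most \<open>\<Sum>\<^sub>i 3^n\<^sub>i (|X\<^sub>i| + 1)\<close> clauses and
  local D-sequents ever occur, where \<open>n\<^sub>i\<close> is the number of variables of component \<open>i\<close>.  Every
  branching call creates a new one of these before it returns, and at most \<open>|Vars(F)|\<close> branching
  calls are in progress when one is created.  This bounds the internal nodes of the binary tree,
  and the number of all nodes is at most twice that plus one.\<close>

section \<open>Literals, clauses and falsification\<close>

lemma vars_simps [simp]:
  "vars {} = {}" "vars (insert l A) = insert (fst l) (vars A)" "vars (A \<union> B) = vars A \<union> vars B"
  "vars (\<Union> \<A>) = (\<Union>A\<in>\<A>. vars A)"
  by (auto simp: vars_def)

lemma vars_falsifier [simp]: "vars (falsifier C) = vars C"
  by (force simp: vars_def falsifier_def compl_def)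

lemma vars_resolvent: "vars (resolvent v A B) = (vars A \<union> vars B) - {v}"
  by (force simp: vars_def resolvent_def)

lemma compl_compl [simp]: "compl (compl l) = l"
  by (simp add: compl_def)

lemma fst_compl [simp]: "fst (compl l) = fst l"
  by (simp add: compl_def)

lemma falsifies_iff: "falsifies q C \<longleftrightarrow> (\<forall>l\<in>C. compl l \<in> q)"
  by (auto simp: falsifies_def falsifier_def)

lemma falsifies_mono: "falsifies q C \<Longrightarrow> q \<subseteq> q' \<Longrightarrow> falsifies q' C"
  by (auto simp: falsifies_iff)

lemma falsifies_insert_iff: "v \<notin> vars C \<Longrightarrow> falsifies (insert (v, b) q) C \<longleftrightarrow> falsifies q C"
  by (force simp: falsifies_iff vars_def compl_def)

lemma is_clause_insert: "is_clause q \<Longrightarrow> v \<notin> vars q \<Longrightarrow> is_clause (insert (v, b) q)"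
  by (force simp: is_clause_def vars_def compl_def)

lemma is_clause_subset: "is_clause q \<Longrightarrow> s \<subseteq> q \<Longrightarrow> is_clause s"
  by (auto simp: is_clause_def dest: finite_subset)

text \<open>Consistency and finiteness pass from \<open>q\<close> to the falsifier of
  \<open>C\<close>, and from there to \<open>C\<close> by complementing. Applied to a resolvent
  falsified by \<open>q\<close>, this rules out tautologies.\<close>

lemma is_clause_falsified:
  assumes "is_clause q" "falsifies q C"
  shows "is_clause C"
proof -
  have eq: "C = compl ` falsifier C" by (force simp: falsifier_def)
  have "is_clause (falsifier C)"
    using assms is_clause_subset by (auto simp: falsifies_def)
  then have "compl l \<notin> C" if "l \<in> C" for l
    using that unfolding is_clause_def falsifier_def by blast
  moreover have "finite C" using \<open>is_clause (falsifier C)\<close> eq by (metis finite_imageI is_clause_def)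
  ultimately show ?thesis by (auto simp: is_clause_def)
qed

section \<open>Counting clauses and assignments over a set of variables\<close>

lemma finite_clauses_over: "finite V \<Longrightarrow> finite {s. is_clause s \<and> vars s \<subseteq> V}"
  by (rule finite_subset[of _ "Pow (V \<times> UNIV)"]) (force simp: vars_def)+

text \<open>In a consistent set each variable is absent, positive or negative, hence the base 3. The
  same count serves clauses and assignments.\<close>

lemma card_clauses_over:
  assumes "finite V"
  shows "card {s. is_clause s \<and> vars s \<subseteq> V} \<le> 3 ^ card V"
  using assms
proof (induction V)
  case empty
  have "{s. is_clause s \<and> vars s \<subseteq> {}} \<subseteq> {{}}" by (auto simp: vars_def)
  from card_mono[OF _ this] show ?case by simp
next
  case (insert v V)
  let ?A = "{s. is_clause s \<and> vars s \<subseteq> V}"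
  let ?B = "{s. is_clause s \<and> vars s \<subseteq> insert v V}"
  have "?B \<subseteq> ?A \<union> insert (v, True) ` ?A \<union> insert (v, False) ` ?A"
  proof
    fix s assume s: "s \<in> ?B"
    define t where "t = {l \<in> s. fst l \<noteq> v}"
    have t: "t \<in> ?A" using s is_clause_subset[of s t] by (fastforce simp: t_def vars_def)
    have "\<not> ((v, True) \<in> s \<and> (v, False) \<in> s)" using s by (force simp: is_clause_def compl_def)
    then have "s = t \<or> s = insert (v, True) t \<or> s = insert (v, False) t"
      unfolding t_def by (safe; (case_tac b)?; fastforce?)
    with t show "s \<in> ?A \<union> insert (v, True) ` ?A \<union> insert (v, False) ` ?A" by blast
  qed
  moreover have fin: "finite ?A" using insert.hyps(1) by (rule finite_clauses_over)
  ultimately have "card ?B \<le> card (?A \<union> insert (v, True) ` ?A \<union> insert (v, False) ` ?A)"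
    by (intro card_mono) auto
  also have "\<dots> \<le> card ?A + card ?A + card ?A"
    by (intro order_trans[OF card_Un_le] add_mono card_image_le fin order_refl)
  also have "\<dots> \<le> 3 ^ card (insert v V)" using insert by simp
  finally show ?case .
qed

section \<open>Single steps of the procedure\<close>

inductive_cases dds_LeafE: "dds X F \<Pi> q \<Omega> Leaf F' \<Pi>' \<Omega>' ans"

text \<open>For \<open>Sat\<close> only the absence of a falsified clause is recorded, not
  satisfiability; this is the property from which locality of active D-sequents follows.\<close>

fun answer_correct :: "'v assignment \<Rightarrow> 'v cnf \<Rightarrow> 'v answer \<Rightarrow> bool" where
  "answer_correct q F Sat \<longleftrightarrow> (\<forall>C\<in>F. \<not> falsifies q C)"
| "answer_correct q F (Unsat C) \<longleftrightarrow> C \<in> F \<and> falsifies q C"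

lemma reuse_complete:
  assumes "reuse X \<Pi> q \<Omega> \<Omega>'" "(s, x) \<in> \<Pi>" "s \<subseteq> q" "x \<in> X - vars q"
  shows "x \<in> red_vars \<Omega>'"
proof -
  let ?R = "{x \<in> X - vars q - red_vars \<Omega>. \<exists>s. (s, x) \<in> active q \<Pi>}"
  obtain f where "\<Omega>' = \<Omega> \<union> (\<lambda>x. (f x, x)) ` ?R"
    using assms(1) unfolding reuse_def Let_def by blast
  then have "red_vars \<Omega>' = red_vars \<Omega> \<union> ?R" by (simp add: red_vars_def image_Un image_image)
  moreover have "(s, x) \<in> active q \<Pi>" using assms(2,3) by (simp add: active_def)
  ultimately show ?thesis using assms(4) by blast
qed

lemma reuse_subset: "reuse X \<Pi> q \<Omega> \<Omega>' \<Longrightarrow> \<Omega> \<subseteq> \<Omega>' \<and> \<Omega>' \<subseteq> \<Omega> \<union> active q \<Pi>"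
  unfolding reuse_def Let_def by auto

lemma blocked_step_mono: "blocked_step X F q \<Omega> \<Omega>' \<Longrightarrow> \<Omega> \<subseteq> \<Omega>'"
  by (erule blocked_step.cases) auto

lemma add_blocked_mono: "add_blocked X F q \<Omega> \<Omega>' \<Longrightarrow> \<Omega> \<subseteq> \<Omega>'"
proof -
  have "(blocked_step X F q)\<^sup>*\<^sup>* \<Omega> \<Omega>' \<Longrightarrow> \<Omega> \<subseteq> \<Omega>'"
    by (induction rule: rtranclp_induct) (auto dest: blocked_step_mono)
  then show "add_blocked X F q \<Omega> \<Omega>' \<Longrightarrow> \<Omega> \<subseteq> \<Omega>'" by (simp add: add_blocked_def)
qed

lemma branches_var:
  assumes "branches X F \<Pi> q \<Omega> \<Omega>b v b"
  shows "v \<notin> vars q" "v \<in> cnf_vars F \<union> X"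
  using assms by (auto simp: branches_def pick_branch_def branch_vars_def Let_def split: if_splits)

lemma branches_not_falsified:
  "branches X F \<Pi> q \<Omega> \<Omega>b v b \<Longrightarrow> C \<in> F \<Longrightarrow> \<not> falsifies q C"
  by (auto simp: branches_def)

text \<open>Here the store of D-sequents matters: a stored active D-sequent for \<open>x\<close>
  would have been reused before branching, and \<open>add_blocked\<close> only enlarges the set, so
  \<open>x\<close> would be redundant.\<close>

lemma branches_fresh:
  assumes "branches X F \<Pi> q \<Omega> \<Omega>b v b" "x \<in> X - vars q - red_vars \<Omega>b" "s \<subseteq> q"
  shows "(s, x) \<notin> \<Pi> \<union> \<Omega>b"
proof
  assume *: "(s, x) \<in> \<Pi> \<union> \<Omega>b"
  obtain \<Omega>r where r: "reuse X \<Pi> q \<Omega> \<Omega>r" "add_blocked X F q \<Omega>r \<Omega>b"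
    using assms(1) by (auto simp: branches_def)
  have "(s, x) \<notin> \<Omega>b" using assms(2) by (force simp: red_vars_def)
  with * reuse_complete[OF r(1) _ assms(3), of x] assms(2) have "x \<in> red_vars \<Omega>r" by auto
  with add_blocked_mono[OF r(2)] assms(2) show False by (auto simp: red_vars_def)
qed

lemma not_reason:
  assumes "\<nexists>s. reason q \<Omega> C s"
  shows "\<not> satisfies q C" "vars C \<inter> red_vars \<Omega> = {}"
proof -
  show *: "\<not> satisfies q C"
  proof
    assume "satisfies q C"
    then obtain l where "l \<in> q \<inter> C" by (auto simp: satisfies_def)
    with \<open>satisfies q C\<close> have "reason q \<Omega> C {l}" by (auto simp: reason_def)
    with assms show False by blast
  qed
  show "vars C \<inter> red_vars \<Omega> = {}"
    using assms * by (force simp: reason_def red_vars_def)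
qed

text \<open>As \<open>v\<close> is not blocked, some pair of clauses resolvable on \<open>v\<close> is neither satisfied nor
  redundant.  All other unassigned variables in it would be redundant quantified variables or
  detached free ones, so the two clauses are the opposite units of \<open>v\<close> in \<open>F\<^sub>q\<close>.\<close>

lemma last_variable_conflict:
  assumes br: "branches X F \<Pi> q \<Omega> \<Omega>b v b" and last: "X - vars q - red_vars \<Omega>b \<subseteq> {v}"
    and cl: "\<forall>C\<in>F. is_clause C"
  shows "\<exists>C\<in>F. falsifies (insert (v, c) q) C"
proof -
  let ?U = "X - vars q - red_vars \<Omega>b"
  have U: "?U = {v}" using br last by (auto simp: branches_def)
  \<comment> \<open>The branching variable \<open>v\<close> is quantified by \<open>U\<close>, and
    such variables are offered only if every unassigned free variable is detached.\<close>
  have det: "detached X F q \<Omega>b y" if "y \<in> cnf_vars F - X - vars q" for y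
    using br U that by (auto simp: branches_def pick_branch_def branch_vars_def Let_def split: if_splits)
  \<comment> \<open>\<open>add_blocked\<close> stops only when its rule applies to no further
    variable, and \<open>v\<close> is still without a D-sequent.\<close>
  have "\<nexists>S. blocked_dseq F q \<Omega>b v S"
  proof
    assume "\<exists>S. blocked_dseq F q \<Omega>b v S"
    then obtain S where "blocked_dseq F q \<Omega>b v S" ..
    moreover have "v \<in> X - vars q" "v \<notin> red_vars \<Omega>b" using U by blast+
    ultimately have "blocked_step X F q \<Omega>b (insert S \<Omega>b)" by (intro blocked_step.intros)
    with br show False by (auto simp: branches_def add_blocked_def)
  qed
  then have "\<exists>P\<in>res_pairs F v. \<nexists>s. reason q \<Omega>b (fst P) s \<or> reason q \<Omega>b (snd P) s"
  proof (rule contrapos_np)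
    assume "\<not> (\<exists>P\<in>res_pairs F v. \<nexists>s. reason q \<Omega>b (fst P) s \<or> reason q \<Omega>b (snd P) s)"
    then have "\<forall>P\<in>res_pairs F v. \<exists>s. reason q \<Omega>b (fst P) s \<or> reason q \<Omega>b (snd P) s" by blast
    from bchoice[OF this] obtain r where
      "\<forall>P\<in>res_pairs F v. reason q \<Omega>b (fst P) (r P) \<or> reason q \<Omega>b (snd P) (r P)" ..
    then have "blocked_dseq F q \<Omega>b v (\<Union> (r ` res_pairs F v), v)"
      unfolding blocked_dseq_def by (intro exI[of _ r]) auto
    then show "\<exists>S. blocked_dseq F q \<Omega>b v S" ..
  qed
  then obtain C D where CD: "C \<in> F" "D \<in> F" "(v, True) \<in> C" "(v, False) \<in> D"
    "\<nexists>s. reason q \<Omega>b C s" "\<nexists>s. reason q \<Omega>b D s"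
    by (force simp: res_pairs_def)
  have unit: "falsifies (insert (v, \<not> d) q) E"
    if E: "E \<in> F" "(v, d) \<in> E" "\<nexists>s. reason q \<Omega>b E s" for E d
  proof -
    note nr = not_reason[OF E(3)]
    have vE: "vars E \<subseteq> insert v (vars q)"
    proof
      fix w assume w: "w \<in> vars E"
      show "w \<in> insert v (vars q)"
      proof (rule ccontr)
        assume n: "w \<notin> insert v (vars q)"
        then have "w \<notin> X" using nr(2) w U by blast
        with n w E have "w \<in> cnf_vars F - X - vars q" by (auto simp: cnf_vars_def)
        note d = det[OF this]
        \<comment> \<open>This restricted clause contains \<open>w\<close> and the quantified
          \<open>v\<close>, so detachment of \<open>w\<close> makes it redundant, contrary to the
          choice of \<open>E\<close>.\<close>
        let ?E = "{l \<in> E. compl l \<notin> q}"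
        have "v \<notin> vars q" using U by blast
        then have "v \<in> vars ?E" using E(2) by (force simp: vars_def compl_def)
        moreover have "w \<in> vars ?E" using w n by (force simp: vars_def)
        moreover have "?E \<in> restrict F q" using E nr(1) by (auto simp: restrict_def)
        ultimately have "red_clause \<Omega>b ?E" using d U by (auto simp: detached_def)
        moreover have "vars ?E \<subseteq> vars E" by (auto simp: vars_def)
        ultimately show False using nr(2) by (auto simp: red_clause_def)
      qed
    qed
    show ?thesis unfolding falsifies_iff
    proof
      fix l assume l: "l \<in> E"
      show "compl l \<in> insert (v, \<not> d) q"
      proof (cases "fst l = v")
        case True
        moreover have "compl (v, d) \<notin> E" using cl E by (auto simp: is_clause_def)
        ultimately have "l = (v, d)" using l by (cases l; cases "snd l = d") (auto simp: compl_def)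
        then show ?thesis by (simp add: compl_def)
      next
        case False
        then have "fst l \<in> vars q" using vE l by (force simp: vars_def)
        then obtain e where "(fst l, e) \<in> q" by (force simp: vars_def)
        moreover have "l \<notin> q" using nr(1) l by (auto simp: satisfies_def)
        ultimately show ?thesis by (cases "e = snd l") (auto simp: compl_def)
      qed
    qed
  qed
  \<comment> \<open>One value of \<open>v\<close> falsifies \<open>C\<close>, the other falsifies
    \<open>D\<close>.\<close>
  show ?thesis
    using unit[OF CD(1,3,5)] unit[OF CD(2,4,6)] CD(1,2) by (cases c) auto
qed

section \<open>Components, invariant and progress measure\<close>

text \<open>Variable sets are fixed instead of formulas, because \<open>F\<close> grows during a run
  while the partition of the variables stays.\<close>

locale components =
  fixes X :: "'v set" and I :: "'i set" and V :: "'i \<Rightarrow> 'v set"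
  assumes finite_I: "finite I" and finite_V: "\<And>i. i \<in> I \<Longrightarrow> finite (V i)"
    and disjoint: "\<And>i j. i \<in> I \<Longrightarrow> j \<in> I \<Longrightarrow> x \<in> V i \<Longrightarrow> x \<in> V j \<Longrightarrow> i = j"
    and X_subset: "X \<subseteq> (\<Union>i\<in>I. V i)"
begin

definition all_vars :: "'v set" where "all_vars = (\<Union>i\<in>I. V i)"

definition clauses :: "'v clause set" where
  "clauses = {C. is_clause C \<and> (\<exists>i\<in>I. vars C \<subseteq> V i)}"

definition local_dseq :: "'v dseq \<Rightarrow> bool" where
  "local_dseq S \<longleftrightarrow> (\<exists>i\<in>I. snd S \<in> X \<inter> V i \<and> vars (fst S) \<subseteq> V i)"

text \<open>A falsified clause of one component makes the variables of all components redundant.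
  These are the only non-local D-sequents.\<close>

definition admissible :: "'v cnf \<Rightarrow> 'v dseq \<Rightarrow> bool" where
  "admissible F S \<longleftrightarrow> local_dseq S \<or> (\<exists>C\<in>F. fst S = falsifier C)"

text \<open>The invariant of a call, serving as both precondition and postcondition.
  \<open>is_clause q\<close> expresses that the assignment is finite and consistent.\<close>

definition valid :: "'v cnf \<Rightarrow> 'v dseq set \<Rightarrow> 'v assignment \<Rightarrow> 'v dseq set \<Rightarrow> bool" where
  "valid F \<Pi> q \<Omega> \<longleftrightarrow> F \<subseteq> clauses \<and> is_clause q \<and> vars q \<subseteq> all_vars \<and> \<Omega> \<subseteq> \<Pi> \<and>
     (\<forall>S\<in>\<Omega>. fst S \<subseteq> q) \<and> (\<forall>S\<in>\<Pi>. admissible F S)"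

definition local_dseqs :: "'v dseq set" where
  "local_dseqs = {S. local_dseq S \<and> is_clause (fst S)}"

text \<open>D-sequents that are not local stem from clauses and are accounted for by
  \<open>card F\<close>. Counting them directly would charge every component for all of
  \<open>X\<close> instead of its own quantified variables.\<close>

definition progress :: "'v cnf \<Rightarrow> 'v dseq set \<Rightarrow> nat" where
  "progress F \<Pi> = card F + card (\<Pi> \<inter> local_dseqs)"

lemma finite_all_vars: "finite all_vars"
  using finite_I finite_V by (simp add: all_vars_def)

lemma clauses_eq: "clauses = (\<Union>i\<in>I. {C. is_clause C \<and> vars C \<subseteq> V i})"
  by (auto simp: clauses_def)

lemma local_dseqs_eq:
  "local_dseqs = (\<Union>i\<in>I. {s. is_clause s \<and> vars s \<subseteq> V i} \<times> (X \<inter> V i))"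
  by (simp add: local_dseqs_def local_dseq_def set_eq_iff) blast

lemma finite_clauses: "finite clauses"
  unfolding clauses_eq using finite_I finite_V finite_clauses_over by blast

lemma finite_local_dseqs: "finite local_dseqs"
  unfolding local_dseqs_eq using finite_I finite_V finite_clauses_over by blast

text \<open>Clauses over component \<open>i\<close> give the summand 1, local D-sequents the summand
  \<open>card (X \<inter> V i)\<close>.\<close>

lemma progress_le:
  assumes "F \<subseteq> clauses"
  shows "progress F \<Pi> \<le> (\<Sum>i\<in>I. 3 ^ card (V i) * (card (X \<inter> V i) + 1))"
proof -
  have "card F \<le> card clauses" using assms finite_clauses by (rule card_mono[rotated])
  also have "\<dots> \<le> (\<Sum>i\<in>I. card {C. is_clause C \<and> vars C \<subseteq> V i})"
    unfolding clauses_eq using finite_I by (rule card_UN_le)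
  also have "\<dots> \<le> (\<Sum>i\<in>I. 3 ^ card (V i))"
    using finite_V by (intro sum_mono card_clauses_over)
  finally have c: "card F \<le> (\<Sum>i\<in>I. 3 ^ card (V i))" .
  have "card (\<Pi> \<inter> local_dseqs) \<le> card local_dseqs"
    using finite_local_dseqs by (intro card_mono) auto
  also have "\<dots> \<le> (\<Sum>i\<in>I. card ({s. is_clause s \<and> vars s \<subseteq> V i} \<times> (X \<inter> V i)))"
    unfolding local_dseqs_eq using finite_I by (rule card_UN_le)
  also have "\<dots> \<le> (\<Sum>i\<in>I. 3 ^ card (V i) * card (X \<inter> V i))"
    unfolding card_cartesian_product using finite_V
    by (intro sum_mono mult_right_mono card_clauses_over) auto
  finally show ?thesis using c by (simp add: progress_def sum.distrib algebra_simps)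
qed

lemma progress_mono:
  assumes "F \<subseteq> F'" "\<Pi> \<subseteq> \<Pi>'" "F' \<subseteq> clauses"
  shows "progress F \<Pi> \<le> progress F' \<Pi>'"
  unfolding progress_def using assms finite_clauses finite_local_dseqs
  by (intro add_mono card_mono) (auto intro: finite_subset)

lemma progress_clause:
  assumes "F \<subseteq> F'" "\<Pi> \<subseteq> \<Pi>'" "F' \<subseteq> clauses" "C \<in> F'" "C \<notin> F"
  shows "progress F \<Pi> < progress F' \<Pi>'"
  unfolding progress_def using assms finite_clauses finite_local_dseqs
  by (intro add_less_le_mono card_mono psubset_card_mono) (auto intro: finite_subset)

lemma progress_dseq:
  assumes "F \<subseteq> F'" "\<Pi> \<subseteq> \<Pi>'" "F' \<subseteq> clauses" "S \<in> \<Pi>' \<inter> local_dseqs" "S \<notin> \<Pi>"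
  shows "progress F \<Pi> < progress F' \<Pi>'"
  unfolding progress_def using assms finite_clauses finite_local_dseqs
  by (intro add_le_less_mono card_mono psubset_card_mono) (auto intro: finite_subset)

section \<open>Locality of D-sequents\<close>

lemma local_dseqI: "x \<in> X \<Longrightarrow> i \<in> I \<Longrightarrow> x \<in> V i \<Longrightarrow> vars s \<subseteq> V i \<Longrightarrow> local_dseq (s, x)"
  by (auto simp: local_dseq_def)

lemma local_dseqE:
  assumes "local_dseq (s, x)"
  obtains i where "x \<in> X" "i \<in> I" "x \<in> V i" "vars s \<subseteq> V i"
  using assms by (auto simp: local_dseq_def)

lemma admissible_mono: "admissible F S \<Longrightarrow> F \<subseteq> F' \<Longrightarrow> admissible F' S"
  by (auto simp: admissible_def)

text \<open>A falsifier contained in \<open>q\<close> belongs to a clause falsified by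
  \<open>q\<close>; with none present, only the local alternative of admissibility remains.\<close>

lemma admissible_local:
  assumes "admissible F (s, x)" "s \<subseteq> q" "\<forall>C\<in>F. \<not> falsifies q C"
  shows "local_dseq (s, x)"
  using assms by (auto simp: admissible_def falsifies_def)

text \<open>Every clause containing \<open>x\<close> lies in the component of \<open>x\<close>. So
  does a literal satisfying it, and so does the local D-sequent of a redundant variable in
  it.\<close>

lemma blocked_dseq_local:
  assumes bl: "blocked_dseq F q \<Omega> x S" and x: "x \<in> X" and F: "F \<subseteq> clauses"
    and act: "\<forall>S\<in>\<Omega>. fst S \<subseteq> q" and loc: "\<forall>S\<in>\<Omega>. local_dseq S"
  shows "fst S \<subseteq> q \<and> local_dseq S"
proof -
  obtain i where i: "i \<in> I" "x \<in> V i" using x X_subset by blast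
  obtain r where r: "\<forall>(C, D)\<in>res_pairs F x. reason q \<Omega> C (r (C, D)) \<or> reason q \<Omega> D (r (C, D))"
    and S: "S = (\<Union> (r ` res_pairs F x), x)"
    using bl by (auto simp: blocked_dseq_def)
  have reason_local: "s \<subseteq> q \<and> vars s \<subseteq> V i"
    if C: "C \<in> F" "x \<in> vars C" and s: "reason q \<Omega> C s" for C s
  proof -
    obtain j where j: "j \<in> I" "vars C \<subseteq> V j" using C(1) F by (auto simp: clauses_def)
    with C(2) i disjoint[of i j x] have Ci: "vars C \<subseteq> V i" by blast
    show ?thesis
    proof (cases "satisfies q C")
      case True
      with s obtain l where "l \<in> q \<inter> C" "s = {l}" by (auto simp: reason_def)
      with Ci show ?thesis by (auto simp: vars_def)
    next
      case False
      with s obtain z where z: "z \<in> vars C" "(s, z) \<in> \<Omega>" by (auto simp: reason_def)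
      from z(2) loc have "local_dseq (s, z)" by blast
      then obtain k where k: "k \<in> I" "z \<in> V k" "vars s \<subseteq> V k" by (auto elim: local_dseqE)
      have "i = k" using k z Ci i disjoint[of i k z] by blast
      with k z act show ?thesis by force
    qed
  qed
  have "r P \<subseteq> q \<and> vars (r P) \<subseteq> V i" if P: "P \<in> res_pairs F x" for P
  proof -
    obtain C D where CD: "P = (C, D)" by fastforce
    with P have "C \<in> F" "D \<in> F" "x \<in> vars C" "x \<in> vars D" by (force simp: res_pairs_def vars_def)+
    with r P CD show ?thesis using reason_local by blast
  qed
  then have "\<Union> (r ` res_pairs F x) \<subseteq> q" "vars (\<Union> (r ` res_pairs F x)) \<subseteq> V i"
    unfolding vars_simps by blast+
  with i x local_dseqI[of x i "\<Union> (r ` res_pairs F x)"] show ?thesis unfolding S by simp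
qed

lemma add_blocked_local:
  assumes "add_blocked X F q \<Omega> \<Omega>'" and F: "F \<subseteq> clauses"
    and "\<forall>S\<in>\<Omega>. fst S \<subseteq> q \<and> local_dseq S"
  shows "\<forall>S\<in>\<Omega>'. fst S \<subseteq> q \<and> local_dseq S"
proof -
  have "(blocked_step X F q)\<^sup>*\<^sup>* \<Omega> \<Omega>'" using assms(1) by (simp add: add_blocked_def)
  then show ?thesis using assms(3)
  proof (induction rule: rtranclp_induct)
    case (step \<Omega>1 \<Omega>2)
    from step.hyps(2) show ?case
    proof cases
      case (1 x S)
      then show ?thesis using blocked_dseq_local[OF 1(4) _ F] step.IH[OF step.prems] by auto
    qed
  qed
qed

section \<open>Preservation of the invariant\<close>

lemma valid_dseq:
  assumes "valid F \<Pi> q \<Omega>" "(s, x) \<in> \<Omega>"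
  shows "s \<subseteq> q" "(s, x) \<in> \<Pi>" "admissible F (s, x)"
proof -
  have "\<forall>S\<in>\<Omega>. fst S \<subseteq> q" "\<Omega> \<subseteq> \<Pi>" "\<forall>S\<in>\<Pi>. admissible F S" using assms(1) by (auto simp: valid_def)
  with assms(2) show "s \<subseteq> q" "(s, x) \<in> \<Pi>" "admissible F (s, x)" by (fastforce, blast, blast)
qed

lemma reuse_valid:
  assumes "valid F \<Pi> q \<Omega>" "reuse X \<Pi> q \<Omega> \<Omega>'"
  shows "\<Omega>' \<subseteq> \<Pi>" "\<forall>S\<in>\<Omega>'. fst S \<subseteq> q"
proof -
  have "\<forall>S\<in>active q \<Pi>. fst S \<subseteq> q" "active q \<Pi> \<subseteq> \<Pi>" by (auto simp: active_def)
  moreover have "\<Omega> \<subseteq> \<Pi>" "\<forall>S\<in>\<Omega>. fst S \<subseteq> q" using assms(1) by (simp_all add: valid_def)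
  ultimately show "\<Omega>' \<subseteq> \<Pi>" "\<forall>S\<in>\<Omega>'. fst S \<subseteq> q" using reuse_subset[OF assms(2)] by blast+
qed

lemma reuse_blocked_local:
  assumes v: "valid F \<Pi> q \<Omega>" and r: "reuse X \<Pi> q \<Omega> \<Omega>r" and nf: "\<nexists>C. C \<in> F \<and> falsifies q C"
    and b: "add_blocked X F q \<Omega>r \<Omega>b"
  shows "\<forall>S\<in>\<Omega>b. fst S \<subseteq> q \<and> local_dseq S"
proof (rule add_blocked_local[OF b])
  show "F \<subseteq> clauses" using v by (simp add: valid_def)
  show "\<forall>S\<in>\<Omega>r. fst S \<subseteq> q \<and> local_dseq S"
  proof
    fix S assume "S \<in> \<Omega>r"
    with reuse_valid[OF v r] v have "fst S \<subseteq> q" "admissible F S" by (auto simp: valid_def)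
    with nf show "fst S \<subseteq> q \<and> local_dseq S" using admissible_local[of F "fst S" "snd S" q] by auto
  qed
qed

lemma valid_extend:
  assumes "valid F \<Pi> q \<Omega>" "\<forall>S\<in>\<Omega>'. fst S \<subseteq> q \<and> admissible F S"
  shows "valid F (\<Pi> \<union> \<Omega>') q \<Omega>'"
  using assms by (auto simp: valid_def)

lemma branches_valid:
  assumes v: "valid F \<Pi> q \<Omega>" and br: "branches X F \<Pi> q \<Omega> \<Omega>b v b"
  shows "valid F (\<Pi> \<union> \<Omega>b) q \<Omega>b"
  using br reuse_blocked_local[OF v] by (intro valid_extend[OF v]) (auto simp: branches_def admissible_def)

lemma branches_all_vars:
  assumes v: "valid F \<Pi> q \<Omega>" and br: "branches X F \<Pi> q \<Omega> \<Omega>b v b"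
  shows "v \<in> all_vars - vars q"
proof -
  have "cnf_vars F \<subseteq> all_vars" using v by (force simp: valid_def clauses_def cnf_vars_def all_vars_def)
  with branches_var[OF br] X_subset show ?thesis by (auto simp: all_vars_def)
qed

lemma valid_insert:
  assumes "valid F \<Pi> q \<Omega>" "v \<in> all_vars - vars q"
  shows "valid F \<Pi> (insert (v, b) q) \<Omega>"
  using assms by (auto simp: valid_def is_clause_insert)

lemma branches_first_valid:
  assumes v: "valid F \<Pi> q \<Omega>" and br: "branches X F \<Pi> q \<Omega> \<Omega>b v b"
  shows "valid F (\<Pi> \<union> \<Omega>b) (insert (v, b) q) \<Omega>b"
  by (rule valid_insert[OF branches_valid[OF v br] branches_all_vars[OF v br]])

lemma asymmetric_iff: "S \<in> asymmetric v \<Omega> \<longleftrightarrow> S \<in> \<Omega> \<and> v \<in> vars (fst S)"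
  by (auto simp: asymmetric_def split: prod.splits)

lemma symmetric_active:
  assumes "s \<subseteq> insert (v, b) q" "v \<notin> vars s"
  shows "s \<subseteq> q"
  using assms by (force simp: vars_def)

text \<open>An assignment active below the branch and not mentioning \<open>v\<close> is already
  contained in \<open>q\<close>.\<close>

lemma valid_return:
  assumes "valid F \<Pi> (insert (v, b) q) \<Omega>" "is_clause q" "vars q \<subseteq> all_vars"
  shows "valid F \<Pi> q (\<Omega> - asymmetric v \<Omega>)"
  using assms symmetric_active[of _ v b q]
  by (simp add: valid_def asymmetric_iff) blast

lemma second_valid:
  assumes v0: "valid F\<^sub>0 \<Pi>\<^sub>0 (insert (v, b) q) \<Omega>\<^sub>0" and v: "valid F \<Pi> q \<Omega>"
    and br: "branches X F \<Pi> q \<Omega> \<Omega>b v b"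
  shows "valid F\<^sub>0 \<Pi>\<^sub>0 (insert (v, \<not> b) q) (\<Omega>\<^sub>0 - asymmetric v \<Omega>\<^sub>0)"
  using v by (intro valid_insert valid_return[OF v0] branches_all_vars[OF v br]) (auto simp: valid_def)

lemma unsat_clause_valid:
  assumes v: "valid F \<Pi> q \<Omega>" and C: "C \<in> F" "falsifies q C"
  shows "valid F (\<Pi> \<union> unsat_clause X q C \<Omega>) q (unsat_clause X q C \<Omega>)"
  using v C by (intro valid_extend[OF v]) (auto simp: unsat_clause_def valid_def admissible_def falsifies_def)

text \<open>One of the two branches answered \<open>sat\<close>, so the D-sequent from that branch is local.
  If both contain \<open>v\<close>, the other one is local as well: it is local by itself or the falsifier of a
  clause containing \<open>v\<close>.\<close>

lemma merge_local:
  assumes F: "F\<^sub>0 \<subseteq> F\<^sub>1" "F\<^sub>1 \<subseteq> clauses"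
    and ans: "answer_correct (insert (v, b) q) F\<^sub>0 ans\<^sub>0" "answer_correct (insert (v, \<not> b) q) F\<^sub>1 ans\<^sub>1"
      "ans\<^sub>0 = Sat \<or> ans\<^sub>1 = Sat"
    and nf: "\<forall>C\<in>F\<^sub>1. \<not> falsifies q C"
    and s0: "s\<^sub>0 \<subseteq> insert (v, b) q" "v \<in> vars s\<^sub>0" "admissible F\<^sub>0 (s\<^sub>0, x)"
    and s1: "s\<^sub>1 \<subseteq> insert (v, \<not> b) q" "admissible F\<^sub>1 (s\<^sub>1, x)"
  shows "merge_dseq v (\<not> b) ans\<^sub>0 s\<^sub>0 s\<^sub>1 \<subseteq> q \<and> local_dseq (merge_dseq v (\<not> b) ans\<^sub>0 s\<^sub>0 s\<^sub>1, x)"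
proof
  show "merge_dseq v (\<not> b) ans\<^sub>0 s\<^sub>0 s\<^sub>1 \<subseteq> q"
    using s0(1) s1(1) symmetric_active[OF s1(1)] by (auto simp: merge_dseq_def resolvent_def)
  have clause_comp: "vars s \<subseteq> V i"
    if "admissible F\<^sub>1 (s, x)" "v \<in> vars s" "i \<in> I" "v \<in> V i" "x \<in> V i" for s i
  proof (cases "local_dseq (s, x)")
    case True
    then obtain j where "j \<in> I" "x \<in> V j" "vars s \<subseteq> V j" by (auto elim: local_dseqE)
    with that disjoint[of i j x] show ?thesis by blast
  next
    case False
    with that obtain C where C: "C \<in> F\<^sub>1" "s = falsifier C" by (auto simp: admissible_def)
    then obtain j where "j \<in> I" "vars s \<subseteq> V j" using F by (auto simp: clauses_def)
    with that disjoint[of i j v] show ?thesis by blast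
  qed
  have loc0: "local_dseq (s\<^sub>0, x)" if "ans\<^sub>0 = Sat"
    using that ans(1) by (intro admissible_local[OF s0(3,1)]) auto
  have loc1: "local_dseq (s\<^sub>1, x)" if "ans\<^sub>1 = Sat"
    using that ans(2) by (intro admissible_local[OF s1(2,1)]) auto
  have adm0: "admissible F\<^sub>1 (s\<^sub>0, x)" using s0(3) F(1) by (rule admissible_mono)
  show "local_dseq (merge_dseq v (\<not> b) ans\<^sub>0 s\<^sub>0 s\<^sub>1, x)"
  proof (cases "v \<in> vars s\<^sub>1")
    case True
    \<comment> \<open>Both assignments mention \<open>v\<close>, so locality of either one puts
      \<open>v\<close> and \<open>x\<close> into the same component.\<close>
    have "local_dseq (s\<^sub>0, x) \<or> local_dseq (s\<^sub>1, x)" using ans(3) loc0 loc1 by blast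
    then obtain i where i: "x \<in> X" "i \<in> I" "x \<in> V i" "v \<in> V i"
      using s0(2) True by (auto elim!: local_dseqE)
    have "vars s\<^sub>0 \<subseteq> V i" "vars s\<^sub>1 \<subseteq> V i"
      using clause_comp[OF adm0 s0(2)] clause_comp[OF s1(2) True] i by blast+
    with True i show ?thesis by (auto intro!: local_dseqI simp: merge_dseq_def vars_resolvent)
  next
    case False
    \<comment> \<open>Without \<open>v\<close> the assignment is active in \<open>q\<close> itself,
      where no clause is falsified, so this holds whichever branch answered
      \<open>Sat\<close>.\<close>
    have l1: "local_dseq (s\<^sub>1, x)"
      using s1(2) symmetric_active[OF s1(1) False] nf by (rule admissible_local)
    show ?thesis
    proof (cases "ans\<^sub>0 = Sat")
      case True
      obtain i where i: "x \<in> X" "i \<in> I" "x \<in> V i" "vars s\<^sub>0 \<subseteq> V i"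
        using loc0[OF True] by (auto elim: local_dseqE)
      moreover obtain j where "j \<in> I" "x \<in> V j" "vars s\<^sub>1 \<subseteq> V j"
        using l1 by (auto elim: local_dseqE)
      ultimately have "vars s\<^sub>1 \<subseteq> V i" using disjoint[of i j x] by blast
      with i True False show ?thesis by (auto intro!: local_dseqI simp: merge_dseq_def vars_resolvent)
    qed (use l1 False in \<open>simp add: merge_dseq_def\<close>)
  qed
qed

lemma combine_clauses_falsified:
  assumes "combine_clauses v C\<^sub>0 C\<^sub>1 C" "falsifies (insert (v, b) q) C\<^sub>0"
    "falsifies (insert (v, \<not> b) q) C\<^sub>1"
  shows "falsifies q C"
proof (cases "v \<in> vars C\<^sub>0 \<and> v \<in> vars C\<^sub>1")
  case True
  with assms show ?thesis by (fastforce simp: combine_clauses_def falsifies_iff resolvent_def compl_def)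
next
  case False
  with assms(1) have "C \<in> {C\<^sub>0, C\<^sub>1}" "v \<notin> vars C" by (auto simp: combine_clauses_def)
  with assms(2,3) show ?thesis by (metis falsifies_insert_iff insertE singletonD)
qed

text \<open>A proper resolution step has \<open>v\<close> in both parents, and by disjointness only
  one component contains \<open>v\<close>.\<close>

lemma combine_clauses_component:
  assumes "combine_clauses v C\<^sub>0 C\<^sub>1 C" "C\<^sub>0 \<in> clauses" "C\<^sub>1 \<in> clauses" "is_clause C"
  shows "C \<in> clauses"
proof (cases "v \<in> vars C\<^sub>0 \<and> v \<in> vars C\<^sub>1")
  case True
  obtain i j where ij: "i \<in> I" "vars C\<^sub>0 \<subseteq> V i" "j \<in> I" "vars C\<^sub>1 \<subseteq> V j"
    using assms by (auto simp: clauses_def)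
  with True disjoint[of i j v] have "i = j" by blast
  with ij True assms show ?thesis by (auto simp: clauses_def combine_clauses_def vars_resolvent)
qed (use assms in \<open>auto simp: combine_clauses_def\<close>)

lemma valid_active:
  assumes "valid F \<Pi> q' \<Omega>" "is_clause q" "vars q \<subseteq> all_vars"
  shows "valid F \<Pi> q (active q \<Omega>)"
  using assms by (auto simp: valid_def active_def)

text \<open>The two unsat rules justify nonlocal D-sequents by a clause of \<open>F'\<close>; in the
  \<open>Sat\<close> case no clause is falsified by \<open>q\<close> and everything returned is
  local.\<close>

lemma conclude_valid:
  assumes cq: "is_clause q" "vars q \<subseteq> all_vars"
    and v0: "valid F\<^sub>0 \<Pi>\<^sub>0 (insert (v, b) q) \<Omega>\<^sub>0" and a0: "answer_correct (insert (v, b) q) F\<^sub>0 ans\<^sub>0"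
    and v1: "valid F\<^sub>1 \<Pi>\<^sub>1 (insert (v, \<not> b) q) \<Omega>\<^sub>1" and a1: "answer_correct (insert (v, \<not> b) q) F\<^sub>1 ans\<^sub>1"
    and mono: "F\<^sub>0 \<subseteq> F\<^sub>1"
    and con: "conclude X q v (\<not> b) (asymmetric v \<Omega>\<^sub>0) ans\<^sub>0 F\<^sub>1 \<Omega>\<^sub>1 ans\<^sub>1 F' \<Omega>' ans"
  shows "valid F' (\<Pi>\<^sub>1 \<union> \<Omega>') q \<Omega>' \<and> F\<^sub>1 \<subseteq> F' \<and> answer_correct q F' ans"
  using con
proof cases
  case (both_unsat C\<^sub>0 C\<^sub>1 C)
  have C0: "C\<^sub>0 \<in> F\<^sub>1" "falsifies (insert (v, b) q) C\<^sub>0" using a0 mono both_unsat by auto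
  have C1: "C\<^sub>1 \<in> F\<^sub>1" "falsifies (insert (v, \<not> b) q) C\<^sub>1" using a1 both_unsat by auto
  have F1: "F\<^sub>1 \<subseteq> clauses" using v1 by (simp add: valid_def)
  have f: "falsifies q C" using \<open>combine_clauses v C\<^sub>0 C\<^sub>1 C\<close> C0(2) C1(2) by (rule combine_clauses_falsified)
  have "C \<in> clauses"
    using \<open>combine_clauses v C\<^sub>0 C\<^sub>1 C\<close> C0 C1 F1 is_clause_falsified[OF cq(1) f] by (blast intro: combine_clauses_component[of v C\<^sub>0 C\<^sub>1 C])
  \<comment> \<open>The formula is enlarged by \<open>C\<close> first, so that the D-sequents added
    next have the falsifier of one of its clauses as assignment.\<close>
  then have "valid F' \<Pi>\<^sub>1 q (active q \<Omega>\<^sub>1)"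
    using valid_active[OF v1 cq] both_unsat by (auto simp: valid_def intro: admissible_mono)
  from unsat_clause_valid[OF this _ f] show ?thesis using both_unsat f by auto
next
  case (contradicted C)
  with unsat_clause_valid[OF valid_active[OF v1 cq], of C] show ?thesis by auto
next
  case some_sat
  have nf: "\<forall>C\<in>F\<^sub>1. \<not> falsifies q C" using some_sat by blast
  have F1: "F\<^sub>1 \<subseteq> clauses" using v1 by (simp add: valid_def)
  let ?M = "merge q v (\<not> b) ans\<^sub>0 (asymmetric v \<Omega>\<^sub>0) \<Omega>\<^sub>1"
  have M: "fst S \<subseteq> q \<and> local_dseq S" if S: "S \<in> ?M" for S
  proof (cases "S \<in> active q \<Omega>\<^sub>1")
    case True
    then have "fst S \<subseteq> q" "S \<in> \<Omega>\<^sub>1" by (auto simp: active_def)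
    with v1 nf show ?thesis by (cases S) (auto simp: valid_def intro!: admissible_local[where q = q])
  next
    case False
    with S obtain s\<^sub>0 s\<^sub>1 x where S: "S = (merge_dseq v (\<not> b) ans\<^sub>0 s\<^sub>0 s\<^sub>1, x)"
      "(s\<^sub>0, x) \<in> \<Omega>\<^sub>0" "v \<in> vars s\<^sub>0" "(s\<^sub>1, x) \<in> \<Omega>\<^sub>1" by (auto simp: merge_def asymmetric_def)
    note s0 = valid_dseq[OF v0 S(2)]
    note s1 = valid_dseq[OF v1 S(4)]
    from merge_local[OF mono F1 a0 a1 \<open>ans\<^sub>0 = Sat \<or> ans\<^sub>1 = Sat\<close> nf s0(1) S(3) s0(3) s1(1,3)] S(1)
    show ?thesis by simp
  qed
  have "\<Omega>' = ?M \<or> v \<in> X \<and> (\<exists>S. blocked_dseq F\<^sub>1 q ?M v S \<and> \<Omega>' = insert S ?M)"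
    using \<open>add_branch_var X F\<^sub>1 q v ?M \<Omega>'\<close> by (auto simp: add_branch_var_def split: if_splits)
  then have "\<forall>S\<in>\<Omega>'. fst S \<subseteq> q \<and> local_dseq S"
    using M blocked_dseq_local[of F\<^sub>1 q ?M v, OF _ _ F1] by blast
  then have "valid F\<^sub>1 (\<Pi>\<^sub>1 \<union> \<Omega>') q \<Omega>'"
    using valid_extend[OF valid_active[OF v1 cq], of \<Omega>'] by (auto simp: admissible_def)
  with some_sat nf show ?thesis by auto
qed

lemma answer_correct_return:
  "answer_correct (insert l q) F ans \<Longrightarrow> transferable q ans \<Longrightarrow> answer_correct q F ans"
  using falsifies_mono[of q _ "insert l q"] by (cases ans) auto

text \<open>All claims are proved in one induction: the second branch starts from what the first
  returns, and merging relies on the correctness of both answers.\<close>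

theorem dds_valid:
  assumes "dds X F \<Pi> q \<Omega> T F' \<Pi>' \<Omega>' ans" "valid F \<Pi> q \<Omega>"
  shows "valid F' \<Pi>' q \<Omega>' \<and> F \<subseteq> F' \<and> \<Pi> \<subseteq> \<Pi>' \<and> answer_correct q F' ans"
  using assms
proof (induction rule: dds.induct)
  case (unsat_leaf \<Pi> q \<Omega> \<Omega>r C F \<Omega>')
  have "valid F \<Pi> q \<Omega>r"
    using unsat_leaf.prems reuse_valid[OF unsat_leaf.prems unsat_leaf.hyps(1)] by (auto simp: valid_def)
  from unsat_clause_valid[OF this unsat_leaf.hyps(2,3)] unsat_leaf.hyps show ?case by auto
next
  case (sat_leaf \<Pi> q \<Omega> \<Omega>r F \<Omega>')
  have "valid F (\<Pi> \<union> \<Omega>') q \<Omega>'"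
    using reuse_blocked_local[OF sat_leaf.prems sat_leaf.hyps(1-3)]
    by (intro valid_extend[OF sat_leaf.prems]) (auto simp: admissible_def)
  with sat_leaf.hyps show ?case by auto
next
  case (left_only F \<Pi> q \<Omega> \<Omega>b v b T\<^sub>0 F\<^sub>0 \<Pi>\<^sub>0 \<Omega>\<^sub>0 ans\<^sub>0)
  note first = left_only.IH[OF branches_first_valid[OF left_only.prems left_only.hyps(1)]]
  \<comment> \<open>The subtracted set is empty here, so this is validity of
    \<open>\<Omega>\<^sub>0\<close> itself.\<close>
  have "valid F\<^sub>0 \<Pi>\<^sub>0 q (\<Omega>\<^sub>0 - asymmetric v \<Omega>\<^sub>0)"
    using first left_only.prems by (intro valid_return) (auto simp: valid_def)
  with first left_only.hyps answer_correct_return show ?case by auto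
next
  case (both F \<Pi> q \<Omega> \<Omega>b v b T\<^sub>0 F\<^sub>0 \<Pi>\<^sub>0 \<Omega>\<^sub>0 ans\<^sub>0 A T\<^sub>1 F\<^sub>1 \<Pi>\<^sub>1 \<Omega>\<^sub>1 ans\<^sub>1 F' \<Omega>' ans)
  note first = both.IH(1)[OF branches_first_valid[OF both.prems both.hyps(1)]]
  note second = both.IH(2)[unfolded \<open>A = _\<close>, OF second_valid[OF conjunct1[OF first] both.prems both.hyps(1)]]
  have "valid F' (\<Pi>\<^sub>1 \<union> \<Omega>') q \<Omega>' \<and> F\<^sub>1 \<subseteq> F' \<and> answer_correct q F' ans"
    using first second both.prems both.hyps
    by (intro conclude_valid[of q F\<^sub>0 \<Pi>\<^sub>0 v b \<Omega>\<^sub>0 ans\<^sub>0 F\<^sub>1 \<Pi>\<^sub>1 \<Omega>\<^sub>1 ans\<^sub>1]) (auto simp: valid_def)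
  with first second show ?case by auto
qed

section \<open>Progress of branching calls\<close>

text \<open>A call that skips its second branch at a quantified \<open>v\<close> may return no
  D-sequent for \<open>v\<close>; leaves have no such gap, so new D-sequents are sought directly
  above them.\<close>

lemma dds_Leaf:
  assumes "dds X F \<Pi> q \<Omega> Leaf F' \<Pi>' \<Omega>' ans"
  shows "F' = F" "X - vars q \<subseteq> red_vars \<Omega>'"
  using assms by (auto elim!: dds_LeafE simp: unsat_clause_def red_vars_def image_Un)

text \<open>Since \<open>x\<close> was not redundant when branching began, any D-sequent for it that
  is active in \<open>q\<close> is new; being local, it is counted by
  \<open>progress\<close>.\<close>

lemma new_local_dseq:
  assumes v: "valid F \<Pi> q \<Omega>" and br: "branches X F \<Pi> q \<Omega> \<Omega>b v b"
    and x: "x \<in> X - vars q - red_vars \<Omega>b" and s: "s \<subseteq> q" "local_dseq (s, x)" "(s, x) \<in> \<Pi>'"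
    and mono: "\<Pi> \<subseteq> \<Pi>'" "F \<subseteq> F'" "F' \<subseteq> clauses"
  shows "progress F \<Pi> < progress F' \<Pi>'"
proof (rule progress_dseq[OF mono(2,1,3)])
  show "(s, x) \<in> \<Pi>' \<inter> local_dseqs"
    using v s is_clause_subset by (auto simp: valid_def local_dseqs_def)
  show "(s, x) \<notin> \<Pi>" using branches_fresh[OF br x s(1)] by blast
qed

lemma left_only_leaf_progress:
  assumes v: "valid F \<Pi> q \<Omega>" and br: "branches X F \<Pi> q \<Omega> \<Omega>b v b"
    and d: "dds X F (\<Pi> \<union> \<Omega>b) (insert (v, b) q) \<Omega>b Leaf F\<^sub>0 \<Pi>\<^sub>0 \<Omega>\<^sub>0 ans\<^sub>0"
    and sym: "asymmetric v \<Omega>\<^sub>0 = {}" and tr: "transferable q ans\<^sub>0"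
  shows "progress F \<Pi> < progress F\<^sub>0 \<Pi>\<^sub>0"
proof -
  note res = dds_valid[OF d branches_first_valid[OF v br]]
  note leaf = dds_Leaf[OF d]
  have nf: "\<forall>C\<in>F. \<not> falsifies q C" using branches_not_falsified[OF br] by blast
  \<comment> \<open>A transferable unsat answer would name a clause of \<open>F\<close> falsified by
    \<open>q\<close>, but then the call would not have branched.\<close>
  have Sat: "ans\<^sub>0 = Sat" using res tr nf leaf(1) by (cases ans\<^sub>0) auto
  \<comment> \<open>Were \<open>v\<close> the last variable, the leaf would falsify a clause. Hence
    another variable \<open>x\<close> gets a D-sequent there, which is symmetric in \<open>v\<close>
    and thus active in \<open>q\<close>.\<close>
  have "\<not> X - vars q - red_vars \<Omega>b \<subseteq> {v}"
  proof
    assume "X - vars q - red_vars \<Omega>b \<subseteq> {v}"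
    from last_variable_conflict[OF br this] v have "\<exists>C\<in>F. falsifies (insert (v, b) q) C"
      by (auto simp: valid_def clauses_def)
    with res Sat leaf(1) show False by auto
  qed
  then obtain x where x: "x \<in> X - vars q - red_vars \<Omega>b" "x \<noteq> v" by blast
  then obtain s where s: "(s, x) \<in> \<Omega>\<^sub>0" using leaf(2) by (force simp: red_vars_def)
  have sq: "s \<subseteq> q"
    using s sym valid_dseq(1)[OF conjunct1[OF res] s] symmetric_active[of s v b q]
    by (auto simp: asymmetric_def)
  have "admissible F (s, x)" "(s, x) \<in> \<Pi>\<^sub>0"
    using valid_dseq[OF conjunct1[OF res] s] leaf(1) by auto
  with admissible_local sq nf have "local_dseq (s, x)" by blast
  from new_local_dseq[OF v br x(1) sq this \<open>(s, x) \<in> \<Pi>\<^sub>0\<close>] res show ?thesis by (auto simp: valid_def)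
qed

text \<open>Leaves leave \<open>F\<close> unchanged and \<open>q\<close> falsified none of its
  clauses, so an unsat answer brings a new clause. A \<open>Sat\<close> answer brings a new local
  D-sequent for some variable other than \<open>v\<close>.\<close>

lemma both_leaves_progress:
  assumes v: "valid F \<Pi> q \<Omega>" and br: "branches X F \<Pi> q \<Omega> \<Omega>b v b"
    and d0: "dds X F (\<Pi> \<union> \<Omega>b) (insert (v, b) q) \<Omega>b Leaf F\<^sub>0 \<Pi>\<^sub>0 \<Omega>\<^sub>0 ans\<^sub>0"
    and d1: "dds X F\<^sub>0 \<Pi>\<^sub>0 (insert (v, \<not> b) q) (\<Omega>\<^sub>0 - asymmetric v \<Omega>\<^sub>0) Leaf F\<^sub>1 \<Pi>\<^sub>1 \<Omega>\<^sub>1 ans\<^sub>1"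
    and con: "conclude X q v (\<not> b) (asymmetric v \<Omega>\<^sub>0) ans\<^sub>0 F\<^sub>1 \<Omega>\<^sub>1 ans\<^sub>1 F' \<Omega>' ans"
  shows "progress F \<Pi> < progress F' (\<Pi>\<^sub>1 \<union> \<Omega>')"
proof -
  note r0 = dds_valid[OF d0 branches_first_valid[OF v br]]
  note r1 = dds_valid[OF d1 second_valid[OF conjunct1[OF r0] v br]]
  have "is_clause q" "vars q \<subseteq> all_vars" using v by (auto simp: valid_def)
  with r0 r1 con have r: "valid F' (\<Pi>\<^sub>1 \<union> \<Omega>') q \<Omega>' \<and> F\<^sub>1 \<subseteq> F' \<and> answer_correct q F' ans"
    by (intro conclude_valid) auto
  then have F': "F' \<subseteq> clauses" by (simp add: valid_def)
  have mono: "F \<subseteq> F'" "\<Pi> \<subseteq> \<Pi>\<^sub>1 \<union> \<Omega>'" using r r0 r1 by auto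
  have eq: "F\<^sub>0 = F" "F\<^sub>1 = F" using dds_Leaf[OF d0] dds_Leaf[OF d1] by auto
  have nf: "\<forall>C\<in>F. \<not> falsifies q C" using branches_not_falsified[OF br] by blast
  show ?thesis
  proof (cases ans)
    case (Unsat C)
    with r nf have "C \<in> F'" "C \<notin> F" by auto
    then show ?thesis using mono F' by (intro progress_clause) auto
  next
    case Sat
    have "F' = F" using con eq Sat by (auto elim: conclude.cases)
    have either: "ans\<^sub>0 = Sat \<or> ans\<^sub>1 = Sat" and
      ext: "merge q v (\<not> b) ans\<^sub>0 (asymmetric v \<Omega>\<^sub>0) \<Omega>\<^sub>1 \<subseteq> \<Omega>'"
      using con Sat by (auto elim!: conclude.cases simp: add_branch_var_def split: if_splits)
    \<comment> \<open>Otherwise both values of \<open>v\<close> falsify a clause, and neither leaf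
      could have answered \<open>Sat\<close>.\<close>
    have "\<not> X - vars q - red_vars \<Omega>b \<subseteq> {v}"
    proof
      assume "X - vars q - red_vars \<Omega>b \<subseteq> {v}"
      from last_variable_conflict[OF br this] v have "\<exists>C\<in>F. falsifies (insert (v, c) q) C" for c
        by (auto simp: valid_def clauses_def)
      with either r0 r1 eq show False by fastforce
    qed
    then obtain x where x: "x \<in> X - vars q - red_vars \<Omega>b" "x \<noteq> v" by blast
    obtain s\<^sub>0 where s0: "(s\<^sub>0, x) \<in> \<Omega>\<^sub>0" using dds_Leaf(2)[OF d0] x by (force simp: red_vars_def)
    obtain s\<^sub>1 where s1: "(s\<^sub>1, x) \<in> \<Omega>\<^sub>1" using dds_Leaf(2)[OF d1] x by (force simp: red_vars_def)
    have "\<exists>s. s \<subseteq> q \<and> (s, x) \<in> \<Pi>\<^sub>1 \<union> \<Omega>'"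
    proof (cases "v \<in> vars s\<^sub>0")
      case True
      with s0 s1 have "(merge_dseq v (\<not> b) ans\<^sub>0 s\<^sub>0 s\<^sub>1, x) \<in> \<Omega>'"
        by (intro subsetD[OF ext]) (auto simp: merge_def asymmetric_def)
      moreover from this r have "merge_dseq v (\<not> b) ans\<^sub>0 s\<^sub>0 s\<^sub>1 \<subseteq> q" using valid_dseq(1) by blast
      ultimately show ?thesis by blast
    next
      case False
      \<comment> \<open>No merging takes place in this case; the D-sequent stored by the first leaf
        is itself active in \<open>q\<close>.\<close>
      have "s\<^sub>0 \<subseteq> insert (v, b) q" "(s\<^sub>0, x) \<in> \<Pi>\<^sub>1"
        using valid_dseq[OF conjunct1[OF r0] s0] r1 by blast+
      with symmetric_active[OF _ False] show ?thesis by blast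
    qed
    then obtain s where s: "s \<subseteq> q" "(s, x) \<in> \<Pi>\<^sub>1 \<union> \<Omega>'" by blast
    from s(2) r have "admissible F' (s, x)" by (auto simp: valid_def)
    with s nf \<open>F' = F\<close> have "local_dseq (s, x)" by (blast intro: admissible_local)
    from new_local_dseq[OF v br x(1) s(1) this s(2)] mono F' show ?thesis by blast
  qed
qed

text \<open>Below every branching call there is one both of whose branches are leaves, so it suffices to
  find a new clause or a new local D-sequent there.\<close>

theorem dds_progress:
  assumes "dds X F \<Pi> q \<Omega> T F' \<Pi>' \<Omega>' ans" "valid F \<Pi> q \<Omega>" "T \<noteq> Leaf"
  shows "progress F \<Pi> < progress F' \<Pi>'"
  using assms
proof (induction rule: dds.induct)
  case (left_only F \<Pi> q \<Omega> \<Omega>b v b T\<^sub>0 F\<^sub>0 \<Pi>\<^sub>0 \<Omega>\<^sub>0 ans\<^sub>0)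
  note pre = branches_first_valid[OF left_only.prems(1) left_only.hyps(1)]
  show ?case
  proof (cases "T\<^sub>0 = Leaf")
    case True
    with left_only show ?thesis using left_only_leaf_progress by blast
  next
    case False
    have "progress F \<Pi> \<le> progress F (\<Pi> \<union> \<Omega>b)" using pre by (intro progress_mono) (auto simp: valid_def)
    also have "\<dots> < progress F\<^sub>0 \<Pi>\<^sub>0" using left_only.IH[OF pre False] .
    finally show ?thesis .
  qed
next
  case (both F \<Pi> q \<Omega> \<Omega>b v b T\<^sub>0 F\<^sub>0 \<Pi>\<^sub>0 \<Omega>\<^sub>0 ans\<^sub>0 A T\<^sub>1 F\<^sub>1 \<Pi>\<^sub>1 \<Omega>\<^sub>1 ans\<^sub>1 F' \<Omega>' ans)
  note pre0 = branches_first_valid[OF both.prems(1) both.hyps(1)]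
  note r0 = dds_valid[OF both.hyps(2) pre0]
  note pre1 = second_valid[OF conjunct1[OF r0] both.prems(1) both.hyps(1)]
  note r1 = dds_valid[OF both.hyps(5)[unfolded \<open>A = _\<close>] pre1]
  have "is_clause q" "vars q \<subseteq> all_vars" using both.prems by (auto simp: valid_def)
  with r0 r1 both.hyps(6) have r: "valid F' (\<Pi>\<^sub>1 \<union> \<Omega>') q \<Omega>' \<and> F\<^sub>1 \<subseteq> F' \<and> answer_correct q F' ans"
    unfolding \<open>A = _\<close> by (intro conclude_valid) auto
  have le: "progress F \<Pi> \<le> progress F (\<Pi> \<union> \<Omega>b)" "progress F (\<Pi> \<union> \<Omega>b) \<le> progress F\<^sub>0 \<Pi>\<^sub>0"
    "progress F\<^sub>0 \<Pi>\<^sub>0 \<le> progress F\<^sub>1 \<Pi>\<^sub>1" "progress F\<^sub>1 \<Pi>\<^sub>1 \<le> progress F' (\<Pi>\<^sub>1 \<union> \<Omega>')"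
    using pre0 r0 r1 r by (auto intro!: progress_mono simp: valid_def)
  show ?case
  proof (cases "T\<^sub>0 = Leaf \<and> T\<^sub>1 = Leaf")
    case True
    with both show ?thesis using both_leaves_progress by blast
  next
    case False
    then have "progress F (\<Pi> \<union> \<Omega>b) < progress F\<^sub>0 \<Pi>\<^sub>0 \<or> progress F\<^sub>0 \<Pi>\<^sub>0 < progress F\<^sub>1 \<Pi>\<^sub>1"
      using both.IH(1)[OF pre0] both.IH(2)[unfolded \<open>A = _\<close>, OF pre1] by blast
    with le show ?thesis by linarith
  qed
qed auto

section \<open>Counting the nodes\<close>

lemma card_unassigned:
  assumes "v \<in> all_vars - vars q"
  shows "card (all_vars - vars q) = Suc (card (all_vars - vars (insert (v, b) q)))"
proof -
  have "all_vars - vars (insert (v, b) q) = all_vars - vars q - {v}" by auto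
  with assms finite_all_vars show ?thesis by (metis card_Suc_Diff1 finite_Diff)
qed

text \<open>A new clause or D-sequent is counted once for every call in progress; branching calls can be
  nested only as deep as there are unassigned variables.\<close>

theorem dds_nodes:
  assumes "dds X F \<Pi> q \<Omega> T F' \<Pi>' \<Omega>' ans" "valid F \<Pi> q \<Omega>"
  shows "nodes T \<le> 2 * card (all_vars - vars q) * (progress F' \<Pi>' - progress F \<Pi>) + 1"
  using assms
proof (induction rule: dds.induct)
  case (left_only F \<Pi> q \<Omega> \<Omega>b v b T\<^sub>0 F\<^sub>0 \<Pi>\<^sub>0 \<Omega>\<^sub>0 ans\<^sub>0)
  note pre = branches_first_valid[OF left_only.prems(1) left_only.hyps(1)]
  define m where "m = card (all_vars - vars (insert (v, b) q))"
  have m: "card (all_vars - vars q) = Suc m"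
    using card_unassigned[OF branches_all_vars[OF left_only.prems left_only.hyps(1)]] unfolding m_def .
  have le: "progress F \<Pi> \<le> progress F (\<Pi> \<union> \<Omega>b)" using pre by (intro progress_mono) (auto simp: valid_def)
  define d where "d = progress F\<^sub>0 \<Pi>\<^sub>0 - progress F \<Pi>"
  have d: "1 \<le> d"
    using dds_progress[OF dds.left_only[OF left_only.hyps] left_only.prems] by (simp add: d_def)
  have "nodes T\<^sub>0 \<le> 2 * m * (progress F\<^sub>0 \<Pi>\<^sub>0 - progress F (\<Pi> \<union> \<Omega>b)) + 1"
    using left_only.IH[OF pre] by (simp add: m_def)
  also have "\<dots> \<le> 2 * m * d + 1" using le by (simp add: d_def diff_le_mono2)
  finally have "nodes (Left_Only v T\<^sub>0) \<le> 2 * m * d + 2" by simp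
  also have "\<dots> \<le> 2 * Suc m * d + 1" using d by simp
  finally show ?case unfolding m d_def .
next
  case (both F \<Pi> q \<Omega> \<Omega>b v b T\<^sub>0 F\<^sub>0 \<Pi>\<^sub>0 \<Omega>\<^sub>0 ans\<^sub>0 A T\<^sub>1 F\<^sub>1 \<Pi>\<^sub>1 \<Omega>\<^sub>1 ans\<^sub>1 F' \<Omega>' ans)
  note pre0 = branches_first_valid[OF both.prems(1) both.hyps(1)]
  note r0 = dds_valid[OF both.hyps(2) pre0]
  note pre1 = second_valid[OF conjunct1[OF r0] both.prems(1) both.hyps(1)]
  note r1 = dds_valid[OF both.hyps(5)[unfolded \<open>A = _\<close>] pre1]
  have "is_clause q" "vars q \<subseteq> all_vars" using both.prems by (auto simp: valid_def)
  with r0 r1 both.hyps(6) have r: "valid F' (\<Pi>\<^sub>1 \<union> \<Omega>') q \<Omega>' \<and> F\<^sub>1 \<subseteq> F' \<and> answer_correct q F' ans"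
    unfolding \<open>A = _\<close> by (intro conclude_valid) auto
  define m where "m = card (all_vars - vars (insert (v, b) q))"
  have m: "card (all_vars - vars q) = Suc m"
    using card_unassigned[OF branches_all_vars[OF both.prems both.hyps(1)]] unfolding m_def .
  define d\<^sub>0 where "d\<^sub>0 = progress F\<^sub>0 \<Pi>\<^sub>0 - progress F (\<Pi> \<union> \<Omega>b)"
  define d\<^sub>1 where "d\<^sub>1 = progress F\<^sub>1 \<Pi>\<^sub>1 - progress F\<^sub>0 \<Pi>\<^sub>0"
  define d where "d = progress F' (\<Pi>\<^sub>1 \<union> \<Omega>') - progress F \<Pi>"
  have "progress F \<Pi> \<le> progress F (\<Pi> \<union> \<Omega>b)" "progress F (\<Pi> \<union> \<Omega>b) \<le> progress F\<^sub>0 \<Pi>\<^sub>0"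
    "progress F\<^sub>0 \<Pi>\<^sub>0 \<le> progress F\<^sub>1 \<Pi>\<^sub>1" "progress F\<^sub>1 \<Pi>\<^sub>1 \<le> progress F' (\<Pi>\<^sub>1 \<union> \<Omega>')"
    using pre0 r0 r1 r by (auto intro!: progress_mono simp: valid_def)
  \<comment> \<open>The progress intervals of the two branches follow one another, so nothing new is
    charged to both.\<close>
  then have dle: "d\<^sub>0 + d\<^sub>1 \<le> d" by (simp add: d_def d\<^sub>0_def d\<^sub>1_def)
  have d: "1 \<le> d"
    using dds_progress[OF dds.both[OF both.hyps] both.prems] by (simp add: d_def)
  have n0: "nodes T\<^sub>0 \<le> 2 * m * d\<^sub>0 + 1"
    using both.IH(1)[OF pre0] by (simp add: m_def d\<^sub>0_def)
  have n1: "nodes T\<^sub>1 \<le> 2 * m * d\<^sub>1 + 1"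
    using both.IH(2)[unfolded \<open>A = _\<close>, OF pre1] by (simp add: m_def d\<^sub>1_def)
  have "nodes (Both v T\<^sub>0 T\<^sub>1) \<le> 2 * m * (d\<^sub>0 + d\<^sub>1) + 3"
    using n0 n1 by (simp add: algebra_simps)
  also have "\<dots> \<le> 2 * m * d + 3" using dle by (simp del: distrib_left_numeral)
  \<comment> \<open>The 3 is the root plus the constant 1 of each subtree; the excess 2 over the
    allowed 1 is paid by the extra \<open>2 * d\<close>.\<close>
  also have "\<dots> \<le> 2 * Suc m * d + 1" using d by simp
  finally show ?case unfolding m d_def .
qed auto

end

text \<open>Without variables the bound would be 0, while every tree has a node; hence the
  assumption that \<open>cnf_vars F\<close> is nonempty.\<close>

theorem proposition12:
  fixes k :: nat and Fs :: "nat \<Rightarrow> 'v cnf" and F :: "'v cnf" and X :: "'v set"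
    and T :: "'v search_tree"
  assumes "\<forall>i\<in>{1..k}. is_cnf (Fs i)"
    and "\<forall>i\<in>{1..k}. \<forall>j\<in>{1..k}. i \<noteq> j \<longrightarrow> cnf_vars (Fs i) \<inter> cnf_vars (Fs j) = {}"
    and "F = (\<Union>i\<in>{1..k}. Fs i)"
    and "X \<subseteq> cnf_vars F"
    and "cnf_vars F \<noteq> {}"
    and "dds_search_tree X F T"
  shows "nodes T \<le> card (cnf_vars F) *
           (\<Sum>i=1..k. eta (X \<inter> cnf_vars (Fs i)) (cnf_vars (Fs i) - X))"
proof -
  let ?V = "\<lambda>i. cnf_vars (Fs i)"
  define J where "J = {1..k}"
  have cF: "cnf_vars F = (\<Union>i\<in>J. ?V i)" using assms(3) by (auto simp: cnf_vars_def J_def)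
  interpret components X J ?V
  proof
    show "finite (?V i)" if "i \<in> J" for i
      using assms(1) that unfolding J_def by (auto simp: is_cnf_def is_clause_def cnf_vars_def vars_def)
    show "i = j" if "i \<in> J" "j \<in> J" "x \<in> ?V i" "x \<in> ?V j" for i j x
      using assms(2) that unfolding J_def by blast
    show "X \<subseteq> (\<Union>i\<in>J. ?V i)" using assms(4) cF by simp
  qed (simp add: J_def)
  have av: "all_vars = cnf_vars F" by (simp add: all_vars_def cF)
  obtain F' \<Pi>' \<Omega>' ans where d: "dds X F {} {} {} T F' \<Pi>' \<Omega>' ans"
    using assms(6) by (auto simp: dds_search_tree_def)
  have "F \<subseteq> clauses"
  proof
    fix C assume "C \<in> F"
    then obtain i where i: "i \<in> J" "C \<in> Fs i" using assms(3) by (auto simp: J_def)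
    then have "is_clause C" using assms(1) by (auto simp: is_cnf_def J_def)
    moreover have "vars C \<subseteq> ?V i" using i by (auto simp: cnf_vars_def)
    ultimately show "C \<in> clauses" using i by (auto simp: clauses_def)
  qed
  then have v: "valid F {} {} {}" by (auto simp: valid_def is_clause_def)
  define M where "M = (\<Sum>i\<in>J. 3 ^ card (?V i) * (card (X \<inter> ?V i) + 1))"
  have "progress F' \<Pi>' \<le> M"
    using dds_valid[OF d v] unfolding M_def by (intro progress_le) (simp add: valid_def)
  \<comment> \<open>A nonempty \<open>F\<close> makes progress start at 1 or more, so at most
    \<open>M - 1\<close> units remain; the spare unit absorbs the \<open>+ 1\<close> of the node
    count.\<close>
  moreover have "F \<noteq> {}" using assms(5) by (auto simp: cnf_vars_def)
  then have "1 \<le> progress F {}"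
    using \<open>F \<subseteq> clauses\<close> finite_clauses finite_subset[of F clauses]
    by (auto simp: progress_def Suc_le_eq card_gt_0_iff)
  ultimately have diff: "progress F' \<Pi>' - progress F {} \<le> M - 1" by linarith
  have M: "1 \<le> M" using \<open>progress F' \<Pi>' \<le> M\<close> \<open>1 \<le> progress F {}\<close> dds_valid[OF d v]
      progress_mono[of F F' "{}" \<Pi>'] by (auto simp: valid_def)
  have n: "1 \<le> card (cnf_vars F)"
    using assms(5) finite_all_vars by (simp add: av Suc_le_eq card_gt_0_iff)
  have "nodes T \<le> 2 * card (cnf_vars F) * (progress F' \<Pi>' - progress F {}) + 1"
    using dds_nodes[OF d v] by (simp add: av)
  also have "\<dots> \<le> 2 * card (cnf_vars F) * (M - 1) + 1" using diff by simp
  also have "\<dots> \<le> 2 * card (cnf_vars F) * M"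
    using M n by (cases M) auto
  also have "\<dots> = card (cnf_vars F) * (\<Sum>i\<in>J. eta (X \<inter> ?V i) (?V i - X))"
  proof -
    have "X \<inter> ?V i \<union> (?V i - X) = ?V i" for i by blast
    \<comment> \<open>The factor 2 in \<open>eta\<close> is the factor 2 of the node count.\<close>
    then have "2 * M = (\<Sum>i\<in>J. eta (X \<inter> ?V i) (?V i - X))"
      by (simp add: M_def eta_def sum_distrib_left mult.assoc)
    then show ?thesis by (metis mult.assoc mult.commute)
  qed
  finally show ?thesis unfolding J_def .
qed

end
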